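(* Let $N,p,q,\sigma$ be real numbers with $q>p-1>0$ and $p<N<-\sigma$. Consider the positive solutions of $$-(|w'|^{p-2}w')'-\frac{N-1}{r}|w'|^{p-2}w'=\varepsilon r^{\sigma}w^{q},\qquad \varepsilon=\pm1 .$$ • For $\varepsilon=\pm1$ there exist local solutions near $\infty$ of three types: $$\lim_{r\to\infty}w=C>0,\qquad \lim_{r\to\infty}r^{-\frac{\sigma+1}{p-1}}w'=\varepsilon c(C),\quad c(C)>0;$$ $$\lim_{r\to\infty}w=0,\qquad \lim_{r\to\infty}r^{\frac{N-p}{p-1}}w=k>0,\qquad \lim_{r\to\infty}r^{\frac{N-1}{p-1}}w'=-c(k)<0;$$ $$\lim_{r\to\infty}w=C>0,\qquad \lim_{r\to\infty}r^{\frac{N-1}{p-1}}w'=D\ne0.$$ For $\varepsilon=1$ they are not global, and there is no solution in $(0,r_0)$, $r_0>0$. For $\varepsilon=-1$ there exist two types of global solutions in $(0,\infty)$: • $w^*(r)=a^*r^{-\frac{p+\sigma}{q+1-p}}$, which is continuous up to $r=0$; • solutions such that $w\sim w^*$ as $r\to0$, $\lim_{r\to\infty}w=C>0$ and $\lim_{r\to\infty}r^{\frac{N-1}{p-1}}w'=c(C)>0$.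
   Context: $N$ is not necessarily an integer. With $\gamma=\frac{p+\sigma}{q+1-p}$, $a^*>0$ is defined by $(a^* )^{q-p+1}=\varepsilon|\gamma|^{p-2}\gamma\,(N-p-(p-1)\gamma)$ with $\varepsilon=-1$. A local solution near $\infty$ is a positive solution on $(r_0,\infty)$ for some $r_0>0$; a solution is global if it is a positive solution on $(0,\infty)$. $c(\cdot)$ denotes a positive constant associated with the solution. $f\sim g$ means $f/g\to1$. *)

theory Defs
  imports "HOL-Analysis.Analysis" "HOL-Library.Landau_Symbols"
begin

definition flux :: "real \<Rightarrow> (real \<Rightarrow> real) \<Rightarrow> real \<Rightarrow> real" where
  "flux p w r = \<bar>deriv w r\<bar> powr (p - 2) * deriv w r"

(* The interval I is meant to be open.  Where w' vanishes the flux |w'|^(p-2) w' is 0, also for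
   p \<le> 2, because 0 powr a = 0.  Continuity of w' and of the derivative of the flux need not be
   required: they follow from differentiability of the flux and from the equation. *)
definition positive_solution ::
  "real \<Rightarrow> real \<Rightarrow> real \<Rightarrow> real \<Rightarrow> real \<Rightarrow> real set \<Rightarrow> (real \<Rightarrow> real) \<Rightarrow> bool" where
  "positive_solution N p q \<sigma> \<epsilon> I w \<longleftrightarrow>
     (\<forall>r\<in>I. 0 < w r \<and> w differentiable (at r) \<and> flux p w differentiable (at r) \<and>
        - deriv (flux p w) r - (N - 1) / r * flux p w r = \<epsilon> * r powr \<sigma> * w r powr q)"

definition local_solution_at_infinity ::
  "real \<Rightarrow> real \<Rightarrow> real \<Rightarrow> real \<Rightarrow> real \<Rightarrow> real \<Rightarrow> (real \<Rightarrow> real) \<Rightarrow> bool" where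
  "local_solution_at_infinity N p q \<sigma> \<epsilon> r\<^sub>0 w \<longleftrightarrow>
     0 < r\<^sub>0 \<and> positive_solution N p q \<sigma> \<epsilon> {r\<^sub>0<..} w"

definition global_solution ::
  "real \<Rightarrow> real \<Rightarrow> real \<Rightarrow> real \<Rightarrow> real \<Rightarrow> (real \<Rightarrow> real) \<Rightarrow> bool" where
  "global_solution N p q \<sigma> \<epsilon> w \<longleftrightarrow> positive_solution N p q \<sigma> \<epsilon> {0<..} w"

definition extends_to_global ::
  "real \<Rightarrow> real \<Rightarrow> real \<Rightarrow> real \<Rightarrow> real \<Rightarrow> real \<Rightarrow> (real \<Rightarrow> real) \<Rightarrow> bool" where
  "extends_to_global N p q \<sigma> \<epsilon> r\<^sub>0 w \<longleftrightarrow>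
     (\<exists>v. global_solution N p q \<sigma> \<epsilon> v \<and> (\<forall>r>r\<^sub>0. v r = w r))"

definition behaviour1 :: "real \<Rightarrow> real \<Rightarrow> real \<Rightarrow> real \<Rightarrow> real \<Rightarrow> (real \<Rightarrow> real) \<Rightarrow> bool" where
  "behaviour1 p \<sigma> \<epsilon> C c w \<longleftrightarrow>
     (w \<longlongrightarrow> C) at_top \<and>
     ((\<lambda>r. r powr (- ((\<sigma> + 1) / (p - 1))) * deriv w r) \<longlongrightarrow> \<epsilon> * c) at_top"

definition behaviour2 :: "real \<Rightarrow> real \<Rightarrow> real \<Rightarrow> real \<Rightarrow> (real \<Rightarrow> real) \<Rightarrow> bool" where
  "behaviour2 N p k c w \<longleftrightarrow>
     (w \<longlongrightarrow> 0) at_top \<and>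
     ((\<lambda>r. r powr ((N - p) / (p - 1)) * w r) \<longlongrightarrow> k) at_top \<and>
     ((\<lambda>r. r powr ((N - 1) / (p - 1)) * deriv w r) \<longlongrightarrow> - c) at_top"

definition behaviour3 :: "real \<Rightarrow> real \<Rightarrow> real \<Rightarrow> real \<Rightarrow> (real \<Rightarrow> real) \<Rightarrow> bool" where
  "behaviour3 N p C D w \<longleftrightarrow>
     (w \<longlongrightarrow> C) at_top \<and>
     ((\<lambda>r. r powr ((N - 1) / (p - 1)) * deriv w r) \<longlongrightarrow> D) at_top"

definition gam :: "real \<Rightarrow> real \<Rightarrow> real \<Rightarrow> real" where
  "gam p q \<sigma> = (p + \<sigma>) / (q + 1 - p)"

definition a_star :: "real \<Rightarrow> real \<Rightarrow> real \<Rightarrow> real \<Rightarrow> real \<Rightarrow> real" where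
  "a_star N p q \<sigma> \<epsilon> =
     (THE a. 0 < a \<and>
        a powr (q - p + 1) =
          \<epsilon> * \<bar>gam p q \<sigma>\<bar> powr (p - 2) * gam p q \<sigma> * (N - p - (p - 1) * gam p q \<sigma>))"

definition w_star :: "real \<Rightarrow> real \<Rightarrow> real \<Rightarrow> real \<Rightarrow> real \<Rightarrow> real \<Rightarrow> real" where
  "w_star N p q \<sigma> \<epsilon> r = a_star N p q \<sigma> \<epsilon> * r powr (- (p + \<sigma>) / (q + 1 - p))"

definition continuous_up_to_zero :: "(real \<Rightarrow> real) \<Rightarrow> bool" where
  "continuous_up_to_zero w \<longleftrightarrow> (\<exists>g. continuous_on {0..} g \<and> (\<forall>r>0. g r = w r))"

end

theory Submission
  imports Defs "HOL-Complex_Analysis.Great_Picard" "HOL-Real_Asymp.Real_Asymp"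
begin

text \<open>
The substitution $t = r^{-m}$ with $m = (N-p)/(p-1) > 0$ turns the radial equation for $w(r) = u(t)$ into
$(|u'|^{p-2}u')' = -\<epsilon>\, m^{-p}\, t^\<beta> u^q$ on the half line, with $\<beta> = -(N+\<sigma>)/m - 1$.
The condition $N < -\<sigma>$ says exactly that $\<beta> > -1$, so that the weight is integrable at $t = 0$, the
image of $r = \<infinity>$. Writing $z = |u'|^{p-2}u'$, solutions near infinity are therefore obtained from solutions
of the Volterra equation $u(t) = C + \<integral>_0^t \<psi>(z)$, $z(s) = A + \<kappa> \<integral>_0^s x^\<beta> u(x)^q\,dx$, where
$\<psi>$ is the odd power with exponent $1/(p-1)$ and $C$, $A$ are free. The three behaviours are $A = 0$,
$C = 0 < A$, and $C > 0 \<noteq> A$.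

Neither $\<psi>$ nor $u \<mapsto> u^q$ is Lipschitz in general, so the Volterra equation is solved by compactness and not by
contraction: Tonelli's delayed equations have explicit solutions, and Arzela--Ascoli gives a limit
(\<^verbatim>\<open>causal_family.fixed_point_limit\<close>). The delayed solutions depend continuously on $A$. Hence the intermediate
value theorem can be applied to them before the limit is taken, and boundary value problems are solved without
any uniqueness statement (\<^verbatim>\<open>causal_family.fixed_point_boundary_value\<close>).

For $\<epsilon> = 1$ the quantity $r^{N-1}|w'|^{p-2}w'$ is decreasing. Near $r = 0$ it can neither be positive, since
then $w$ would become negative, nor stay nonpositive, since then $w$ has a positive lower bound and the equation
drives this quantity to $+\<infinity>$ as $r \<rightarrow> 0$ (\<^verbatim>\<open>no_solution_near_zero\<close>).

For $\<epsilon> = -1$ the power solution $w^*$ becomes $a\,t^{-\<mu>}$, and the global solutions wanted are those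
positive solutions in $t$ that start at $u(0) = C$ and are asymptotic to $a\,t^{-\<mu>}$ as $t \<rightarrow> \<infinity>$.
The functions $a\,(t^\<theta> + B^\<theta>)^{-\<mu>/\<theta>}$ all have the same value at $0$ and the same asymptotics at
infinity; for $\<theta>$ large they are supersolutions, for $\<theta>$ small subsolutions, and they increase with
$\<theta>$. The solution $u_n$ of the boundary value problem on $[0,n]$ that takes the value of the supersolution
at $n$ lies between the two barriers by comparison. The $u_n$ decrease with $n$, and their limit is a global
solution that is squeezed between the barriers, which yields both limits at once
(\<^verbatim>\<open>emden_fowler_barriers.decaying_solution\<close>).
\<close>

section \<open>Odd powers\<close>

text \<open>
The flux is \<open>spow (p - 1)\<close> of the derivative, and \<open>spow (1 / (p - 1))\<close> recovers the derivative from the flux.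
\<close>

definition spow :: "real \<Rightarrow> real \<Rightarrow> real" where
  "spow e s = sgn s * \<bar>s\<bar> powr e"

lemma spow_zero [simp]: "spow e 0 = 0"
  by (simp add: spow_def)

lemma spow_pos: "0 < s \<Longrightarrow> spow e s = s powr e"
  by (simp add: spow_def)

lemma spow_minus: "spow e (- s) = - spow e s"
  by (simp add: spow_def sgn_minus)

lemma spow_inverse: "e \<noteq> 0 \<Longrightarrow> spow (1 / e) (spow e s) = s"
  by (cases "s = 0") (auto simp: spow_def sgn_mult abs_mult powr_powr abs_sgn_eq sgn_mult_abs)

lemma spow_mult: "0 < c \<Longrightarrow> spow e (c * s) = c powr e * spow e s"
  by (simp add: spow_def sgn_mult abs_mult powr_mult)

lemma spow_eq_abs_powr: "\<bar>s\<bar> powr (p - 2) * s = spow (p - 1) s"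
  by (cases "s = 0") (auto simp: spow_def powr_diff sgn_if field_simps power2_eq_square)

lemma spow_mono_strict:
  assumes "0 < e" "s < t" shows "spow e s < spow e t"
proof -
  consider "0 \<le> s" | "s < 0" "0 \<le> t" | "t < 0" by linarith
  then show ?thesis
  proof cases
    case 1 with assms show ?thesis by (cases "s = 0") (auto simp: spow_def powr_less_mono2)
  next
    case 2
    then have "spow e s < 0" "0 \<le> spow e t" by (auto simp: spow_def sgn_if)
    then show ?thesis by linarith
  next
    case 3 with assms show ?thesis by (auto simp: spow_def powr_less_mono2)
  qed
qed

lemma spow_mono: "0 < e \<Longrightarrow> s \<le> t \<Longrightarrow> spow e s \<le> spow e t"
  by (metis le_less spow_mono_strict)

lemma abs_spow: "\<bar>spow e s\<bar> = \<bar>s\<bar> powr e"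
  by (auto simp: spow_def abs_mult abs_sgn_eq)

lemma isCont_spow:
  assumes "0 < e" shows "isCont (spow e) s"
proof (cases "s = 0")
  case False
  have "isCont (\<lambda>s. sgn s * \<bar>s\<bar> powr e) s"
    using False by (intro continuous_intros) auto
  then show ?thesis unfolding spow_def by simp
next
  case True
  have "(\<lambda>s::real. \<bar>s\<bar> powr e) \<midarrow>0\<rightarrow> 0"
    using assms by (intro tendsto_eq_intros | simp)+
  then have "spow e \<midarrow>0\<rightarrow> 0"
    by (subst tendsto_rabs_zero_iff[symmetric]) (simp add: abs_spow)
  with True show ?thesis by (simp add: isCont_def)
qed

lemma continuous_on_spow [continuous_intros]:
  assumes "0 < e" "continuous_on S g" shows "continuous_on S (\<lambda>x. spow e (g x))"
  by (rule continuous_on_compose2[OF _ assms(2), of UNIV])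
     (use assms(1) in \<open>auto intro!: continuous_at_imp_continuous_on isCont_spow\<close>)

lemma tendsto_spow:
  assumes "0 < e" "(g \<longlongrightarrow> l) F" shows "((\<lambda>x. spow e (g x)) \<longlongrightarrow> spow e l) F"
  using assms isCont_spow[of e l] by (metis isCont_tendsto_compose)

section \<open>Fixed points of causal operators\<close>

text \<open>
A Peano theorem for operators with memory. \<open>\<Phi> A v t\<close> depends on \<open>v\<close> only through its values on
\<open>{0..t}\<close>, and the images are equi-Lipschitz; the real parameter \<open>A\<close> is a shooting parameter.
\<close>

locale causal_family =
  fixes T lo hi C M :: real and \<Phi> :: "real \<Rightarrow> (real \<Rightarrow> real) \<Rightarrow> real \<Rightarrow> real"
  assumes T: "0 < T" and M: "0 \<le> M"
    and start: "\<lbrakk>A \<in> {lo..hi}; continuous_on {0..T} v\<rbrakk> \<Longrightarrow> \<Phi> A v 0 = C"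
    and causal: "\<lbrakk>t \<in> {0..T}; \<And>x. x \<in> {0..t} \<Longrightarrow> u x = v x\<rbrakk> \<Longrightarrow> \<Phi> A u t = \<Phi> A v t"
    and lipschitz: "\<lbrakk>A \<in> {lo..hi}; continuous_on {0..T} v; s \<in> {0..T}; t \<in> {0..T}\<rbrakk>
      \<Longrightarrow> \<bar>\<Phi> A v s - \<Phi> A v t\<bar> \<le> M * \<bar>s - t\<bar>"
    and cont: "\<lbrakk>\<And>n. As n \<in> {lo..hi}; As \<longlonglongrightarrow> A; \<And>n. continuous_on {0..T} (us n);
        \<And>x. x \<in> {0..T} \<Longrightarrow> (\<lambda>n. us n x) \<longlonglongrightarrow> u x; continuous_on {0..T} u; t \<in> {0..T}\<rbrakk>
      \<Longrightarrow> (\<lambda>n. \<Phi> (As n) (us n) t) \<longlonglongrightarrow> \<Phi> A u t"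
begin

definition delay :: "real \<Rightarrow> (real \<Rightarrow> real) \<Rightarrow> real \<Rightarrow> real" where
  "delay d u x = u (max 0 (x - d))"

text \<open>
With a positive delay the fixed point equation is solved by iteration alone: each step settles the solution on a
further interval of the length of the delay. The approximants use the delay
\<open>T / Suc n\<close>, so \<open>Suc n\<close> steps cover \<open>{0..T}\<close>.
\<close>

primrec iterate :: "real \<Rightarrow> real \<Rightarrow> nat \<Rightarrow> real \<Rightarrow> real" where
  "iterate A d 0 = (\<lambda>_. C)"
| "iterate A d (Suc k) = \<Phi> A (delay d (iterate A d k))"

definition approximant :: "real \<Rightarrow> nat \<Rightarrow> real \<Rightarrow> real" where
  "approximant A n = iterate A (T / Suc n) (Suc n)"

lemma continuous_on_delay:
  assumes "continuous_on {0..T} u" "0 < d" shows "continuous_on {0..T} (delay d u)"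
  unfolding delay_def using assms(2)
  by (intro continuous_on_compose2[OF assms(1)] continuous_intros) auto

lemma continuous_on_lipschitz:
  assumes "\<And>s t. s \<in> {0..T} \<Longrightarrow> t \<in> {0..T} \<Longrightarrow> \<bar>u s - u t\<bar> \<le> M * \<bar>s - t\<bar>"
  shows "continuous_on {0..T} u"
  by (rule lipschitz_on_continuous_on[of M], rule lipschitz_onI)
     (use assms M in \<open>auto simp: dist_real_def\<close>)

lemma continuous_on_iterate:
  assumes "A \<in> {lo..hi}" "0 < d" shows "continuous_on {0..T} (iterate A d k)"
proof (induction k)
  case (Suc k)
  show ?case
    using lipschitz[OF assms(1) continuous_on_delay[OF Suc assms(2)]]
    by (intro continuous_on_lipschitz) simp
qed auto

lemma iterate_stable:
  assumes "A \<in> {lo..hi}" "0 < d" "t \<in> {0..T}" "t \<le> k * d"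
  shows "iterate A d (Suc k) t = iterate A d k t"
  using assms(3,4)
proof (induction k arbitrary: t)
  case 0
  then have "t = 0" by simp
  moreover have "iterate A d (Suc 0) 0 = C"
    unfolding iterate.simps by (rule start[OF assms(1)]) (auto simp: delay_def)
  ultimately show ?case by simp
next
  case (Suc k)
  have "\<Phi> A (delay d (iterate A d (Suc k))) t = \<Phi> A (delay d (iterate A d k)) t"
  proof (rule causal[OF Suc.prems(1)])
    fix x assume x: "x \<in> {0..t}"
    have "max 0 (x - d) \<in> {0..T}" "max 0 (x - d) \<le> k * d"
      using x Suc.prems assms(2) by (auto simp: algebra_simps)
    from Suc.IH[OF this] show "delay d (iterate A d (Suc k)) x = delay d (iterate A d k) x"
      unfolding delay_def .
  qed
  then show ?case by (simp only: iterate.simps)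
qed

lemma approximant_eq:
  assumes "A \<in> {lo..hi}" "t \<in> {0..T}"
  shows "\<Phi> A (delay (T / Suc n) (approximant A n)) t = approximant A n t"
  using iterate_stable[OF assms(1) _ assms(2), of "T / Suc n" "Suc n"] assms(2) T
  unfolding approximant_def by (simp del: of_nat_Suc)

lemma approximant_lipschitz:
  assumes "A \<in> {lo..hi}" "s \<in> {0..T}" "t \<in> {0..T}"
  shows "\<bar>approximant A n s - approximant A n t\<bar> \<le> M * \<bar>s - t\<bar>"
  unfolding approximant_def iterate.simps
  using T by (intro lipschitz assms continuous_on_delay continuous_on_iterate) auto

lemma approximant_0: "A \<in> {lo..hi} \<Longrightarrow> approximant A n 0 = C"
  unfolding approximant_def iterate.simps
  using T by (intro start continuous_on_delay continuous_on_iterate) auto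

lemma tendsto_iterate:
  assumes "\<And>n. As n \<in> {lo..hi}" "As \<longlonglongrightarrow> A" "A \<in> {lo..hi}" "0 < d" "t \<in> {0..T}"
  shows "(\<lambda>n. iterate (As n) d k t) \<longlonglongrightarrow> iterate A d k t"
  using assms(5)
proof (induction k arbitrary: t)
  case (Suc k)
  show ?case unfolding iterate.simps
  proof (rule cont[OF assms(1,2)])
    show "continuous_on {0..T} (delay d (iterate (As n) d k))" for n
      using assms by (intro continuous_on_delay continuous_on_iterate)
    show "continuous_on {0..T} (delay d (iterate A d k))"
      using assms by (intro continuous_on_delay continuous_on_iterate)
    show "(\<lambda>n. delay d (iterate (As n) d k) x) \<longlonglongrightarrow> delay d (iterate A d k) x" if "x \<in> {0..T}" for x
      unfolding delay_def by (rule Suc.IH) (use that assms(4) in auto)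
  qed (use Suc in auto)
qed auto

lemma continuous_on_approximant:
  assumes "t \<in> {0..T}" shows "continuous_on {lo..hi} (\<lambda>A. approximant A n t)"
  unfolding continuous_on_sequentially approximant_def
  using T tendsto_iterate[OF _ _ _ _ assms] by (auto simp: o_def simp del: iterate.simps)

text \<open>
The parameters may vary along the sequence; this freedom is what allows a boundary condition to be imposed on
every approximant and to be inherited by the limit.
\<close>

lemma fixed_point_limit:
  assumes As: "\<And>n. As n \<in> {lo..hi}"
  obtains A u k where "A \<in> {lo..hi}" "strict_mono (k :: nat \<Rightarrow> nat)" "continuous_on {0..T} u"
    "\<And>t. t \<in> {0..T} \<Longrightarrow> \<Phi> A u t = u t"
    "\<And>t. t \<in> {0..T} \<Longrightarrow> (\<lambda>n. approximant (As (k n)) (k n) t) \<longlonglongrightarrow> u t"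
proof -
  obtain A k1 where A: "A \<in> {lo..hi}" "strict_mono (k1 :: nat \<Rightarrow> nat)" "(As \<circ> k1) \<longlonglongrightarrow> A"
    using As compact_Icc[of lo hi] unfolding compact_def by metis
  define v where "v n = approximant (As (k1 n)) (k1 n)" for n
  have v_lip: "\<bar>v n s - v n t\<bar> \<le> M * \<bar>s - t\<bar>" if "s \<in> {0..T}" "t \<in> {0..T}" for n s t
    unfolding v_def using As that by (intro approximant_lipschitz)
  have v_bound: "norm (v n x) \<le> \<bar>C\<bar> + M * T" if "x \<in> {0..T}" for n x
  proof -
    have "\<bar>v n x - v n 0\<bar> \<le> M * \<bar>x - 0\<bar>" using that by (intro v_lip) auto
    also have "\<dots> \<le> M * T" using that M by (intro mult_left_mono) auto
    finally show ?thesis using approximant_0[OF As] by (auto simp: v_def)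
  qed
  obtain u k2 where u: "continuous_on {0..T} u" "strict_mono (k2 :: nat \<Rightarrow> nat)"
      and conv: "\<And>e. 0 < e \<Longrightarrow> \<exists>N. \<forall>n x. n \<ge> N \<and> x \<in> {0..T} \<longrightarrow> norm (v (k2 n) x - u x) < e"
  proof (rule Arzela_Ascoli[of "{0..T}" v "\<bar>C\<bar> + M * T"])
    fix x e :: real assume x: "x \<in> {0..T}" and e: "0 < e"
    show "\<exists>d. 0 < d \<and> (\<forall>n y. y \<in> {0..T} \<and> norm (x - y) < d \<longrightarrow> norm (v n x - v n y) < e)"
    proof (intro exI[of _ "e / (M + 1)"] conjI allI impI)
      fix n y assume y: "y \<in> {0..T} \<and> norm (x - y) < e / (M + 1)"
      have "\<bar>v n x - v n y\<bar> \<le> M * \<bar>x - y\<bar>" using x y by (intro v_lip) auto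
      also have "\<dots> \<le> (M + 1) * \<bar>x - y\<bar>" by (simp add: mult_right_mono)
      also have "\<dots> < e" using y M by (simp add: field_simps)
      finally show "norm (v n x - v n y) < e" by simp
    qed (use e M in auto)
  qed (use v_bound in auto)
  define k where "k = k1 \<circ> k2"
  have k: "strict_mono k" unfolding k_def using A(2) u(2) by (rule strict_mono_o)
  have lim: "(\<lambda>n. v (k2 n) t) \<longlonglongrightarrow> u t" if "t \<in> {0..T}" for t
    using conv that by (intro LIMSEQ_I) blast
  have Ak: "(\<lambda>n. As (k n)) \<longlonglongrightarrow> A"
    using LIMSEQ_subseq_LIMSEQ[OF A(3) u(2)] by (simp add: k_def o_def)
  \<comment> \<open>the delay tends to zero and the approximants are equi-Lipschitz\<close>
  have delayed: "(\<lambda>n. delay (T / Suc (k n)) (v (k2 n)) x) \<longlonglongrightarrow> u x" if x: "x \<in> {0..T}" for x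
  proof -
    have d0: "(\<lambda>n. M * (T / Suc (k n))) \<longlonglongrightarrow> 0"
    proof -
      have "(\<lambda>n. M * T * inverse (real (Suc n))) \<longlonglongrightarrow> M * T * 0"
        by (intro tendsto_intros LIMSEQ_inverse_real_of_nat)
      from LIMSEQ_subseq_LIMSEQ[OF this k] show ?thesis by (simp add: o_def field_simps)
    qed
    have "(\<lambda>n. delay (T / Suc (k n)) (v (k2 n)) x - v (k2 n) x) \<longlonglongrightarrow> 0"
    proof (rule Lim_null_comparison[OF always_eventually d0], rule allI)
      fix n
      let ?d = "T / Suc (k n)"
      have d: "0 < ?d" using T by simp
      have "\<bar>v (k2 n) (max 0 (x - ?d)) - v (k2 n) x\<bar> \<le> M * \<bar>max 0 (x - ?d) - x\<bar>"
        using x d by (intro v_lip) auto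
      also have "\<dots> \<le> M * ?d"
        using x d M by (intro mult_left_mono) (auto simp: max_def)
      finally show "norm (delay ?d (v (k2 n)) x - v (k2 n) x) \<le> M * ?d"
        by (simp add: delay_def)
    qed
    from tendsto_add[OF this lim[OF x]] show ?thesis by simp
  qed
  have fixp: "\<Phi> A u t = u t" if t: "t \<in> {0..T}" for t
  proof (rule LIMSEQ_unique)
    show "(\<lambda>n. \<Phi> (As (k n)) (delay (T / Suc (k n)) (v (k2 n))) t) \<longlonglongrightarrow> \<Phi> A u t"
    proof (rule cont[OF As Ak _ delayed u(1) t])
      fix n show "continuous_on {0..T} (delay (T / real (Suc (k n))) (v (k2 n)))"
        using T by (intro continuous_on_delay continuous_on_lipschitz v_lip) auto
    qed
    show "(\<lambda>n. \<Phi> (As (k n)) (delay (T / Suc (k n)) (v (k2 n))) t) \<longlonglongrightarrow> u t"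
      using lim[OF t] unfolding v_def k_def o_def by (simp only: approximant_eq[OF As t])
  qed
  show thesis
    by (rule that[OF A(1) k u(1) fixp])
       (use lim in \<open>auto simp: v_def k_def\<close>)
qed

lemma fixed_point:
  assumes "A \<in> {lo..hi}"
  obtains u where "continuous_on {0..T} u" "\<And>t. t \<in> {0..T} \<Longrightarrow> \<Phi> A u t = u t"
proof -
  interpret fixed: causal_family T A A C M \<Phi>
  proof
    fix As :: "nat \<Rightarrow> real" and A' t u and us :: "nat \<Rightarrow> real \<Rightarrow> real"
    assume *: "\<And>n. As n \<in> {A..A}" "As \<longlonglongrightarrow> A'" "\<And>n. continuous_on {0..T} (us n)"
      "\<And>x. x \<in> {0..T} \<Longrightarrow> (\<lambda>n. us n x) \<longlonglongrightarrow> u x" "continuous_on {0..T} u" "t \<in> {0..T}"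
    have "As n \<in> {lo..hi}" for n using *(1)[of n] assms by simp
    from cont[OF this *(2-6)] show "(\<lambda>n. \<Phi> (As n) (us n) t) \<longlonglongrightarrow> \<Phi> A' u t" by simp
  qed (use assms in \<open>auto intro: T M start lipschitz causal\<close>)
  show thesis
    by (rule fixed.fixed_point_limit[of "\<lambda>_. A"]) (use that in auto)
qed

text \<open>
Shooting at the level of the approximants. These are continuous functions of the parameter, whereas the fixed
points themselves need not be unique and so need not form a continuous family.
\<close>

lemma fixed_point_boundary_value:
  assumes lohi: "lo \<le> hi"
    and low: "\<And>u. continuous_on {0..T} u \<Longrightarrow> \<Phi> lo u T \<le> y"
    and high: "\<And>u. continuous_on {0..T} u \<Longrightarrow> y \<le> \<Phi> hi u T"
  obtains A u where "A \<in> {lo..hi}" "continuous_on {0..T} u"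
    "\<And>t. t \<in> {0..T} \<Longrightarrow> \<Phi> A u t = u t" "u T = y"
proof -
  have TT: "T \<in> {0..T}" using T by simp
  have "\<exists>A\<in>{lo..hi}. approximant A n T = y" for n
  proof -
    have c: "continuous_on {0..T} (delay (T / Suc n) (iterate A (T / Suc n) n))" if "A \<in> {lo..hi}" for A
      using T that by (intro continuous_on_delay continuous_on_iterate) auto
    have "approximant lo n T \<le> y" "y \<le> approximant hi n T"
      unfolding approximant_def iterate.simps using lohi c[of lo] c[of hi] low high by auto
    from IVT'[OF this lohi continuous_on_approximant[OF TT]] show ?thesis by auto
  qed
  then obtain As where As: "\<And>n. As n \<in> {lo..hi}" "\<And>n. approximant (As n) n T = y"
    by metis
  show thesis
  proof (rule fixed_point_limit[of As])
    fix A u and k :: "nat \<Rightarrow> nat"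
    assume *: "A \<in> {lo..hi}" "continuous_on {0..T} u" "\<And>t. t \<in> {0..T} \<Longrightarrow> \<Phi> A u t = u t"
      and lim: "\<And>t. t \<in> {0..T} \<Longrightarrow> (\<lambda>n. approximant (As (k n)) (k n) t) \<longlonglongrightarrow> u t"
    have "u T = y" using lim[OF TT] As(2) by (auto dest: LIMSEQ_unique[OF tendsto_const])
    with * show thesis by (intro that)
  qed (use As in auto)
qed

end

section \<open>The quasilinear system as a Volterra equation\<close>

text \<open>
The first order form of $(|u'|^{P-1}u')' = \<kappa>\, t^\<beta> f(u)$ with $z = |u'|^{P-1}u'$.
\<close>

definition flow ::
  "real \<Rightarrow> real \<Rightarrow> real \<Rightarrow> (real \<Rightarrow> real) \<Rightarrow> real set \<Rightarrow> (real \<Rightarrow> real) \<Rightarrow> (real \<Rightarrow> real) \<Rightarrow> bool" where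
  "flow P \<beta> \<kappa> f I u z \<longleftrightarrow>
     (\<forall>t\<in>I. (u has_real_derivative spow (1 / P) (z t)) (at t) \<and>
            (z has_real_derivative \<kappa> * (t powr \<beta> * f (u t))) (at t))"

text \<open>
The nonlinearity is assumed bounded so that the equation can be solved on intervals of any length; powers are
truncated to fit this.
\<close>

locale volterra =
  fixes P \<beta> \<kappa> F C :: real and f :: "real \<Rightarrow> real"
  assumes P: "0 < P" and \<beta>: "- 1 < \<beta>" and cont_f: "continuous_on UNIV f"
    and f_bound: "\<And>x. \<bar>f x\<bar> \<le> F"
begin

definition momentum :: "real \<Rightarrow> (real \<Rightarrow> real) \<Rightarrow> real \<Rightarrow> real" where
  "momentum A v s = A + \<kappa> * integral {0..s} (\<lambda>x. x powr \<beta> * f (v x))"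

definition volterra :: "real \<Rightarrow> (real \<Rightarrow> real) \<Rightarrow> real \<Rightarrow> real" where
  "volterra A v t = C + integral {0..t} (\<lambda>s. spow (1 / P) (momentum A v s))"

lemma F_nonneg: "0 \<le> F"
  using f_bound[of 0] by linarith

lemma weight_bound: "\<bar>x powr \<beta> * f y\<bar> \<le> F * x powr \<beta>"
  using mult_left_mono[OF f_bound[of y], of "x powr \<beta>"] by (simp add: abs_mult mult.commute)

lemma integrable_weight:
  assumes "continuous_on {0..s} v"
  shows "(\<lambda>x. x powr \<beta> * f (v x)) integrable_on {0..s}"
proof (cases "0 \<le> s")
  case True
  have c: "continuous_on {0..s} (\<lambda>x. f (v x))"
    using continuous_on_compose2[OF cont_f assms] by simp
  have "(\<lambda>x. x powr \<beta>) absolutely_integrable_on {0..s}"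
    using has_integral_powr_from_0[OF \<beta> True]
    by (intro nonnegative_absolutely_integrable_1) (auto simp: integrable_on_def)
  then have "(\<lambda>x. f (v x) * x powr \<beta>) absolutely_integrable_on {0..s}"
    using c by (intro absolutely_integrable_bounded_measurable_product_real)
      (auto intro: continuous_imp_measurable_on_sets_lebesgue compact_imp_bounded compact_continuous_image)
  then show ?thesis by (simp add: absolutely_integrable_on_def mult.commute)
qed auto

lemma integral_weight_bound:
  assumes "continuous_on {0..s} v" "0 \<le> s"
  shows "\<bar>integral {0..s} (\<lambda>x. x powr \<beta> * f (v x))\<bar> \<le> F * (s powr (\<beta> + 1) / (\<beta> + 1))"
proof -
  have h: "((\<lambda>x. F * x powr \<beta>) has_integral F * (s powr (\<beta> + 1) / (\<beta> + 1))) {0..s}"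
    by (intro has_integral_mult_right has_integral_powr_from_0 \<beta> assms)
  have "norm (integral {0..s} (\<lambda>x. x powr \<beta> * f (v x))) \<le> integral {0..s} (\<lambda>x. F * x powr \<beta>)"
    using h weight_bound integrable_weight[OF assms(1)]
    by (intro integral_norm_bound_integral) (auto simp: integrable_on_def)
  with integral_unique[OF h] show ?thesis by (simp only: real_norm_def)
qed

lemma momentum_bound:
  assumes "continuous_on {0..T} v" "s \<in> {0..T}"
  shows "\<bar>momentum A v s - A\<bar> \<le> \<bar>\<kappa>\<bar> * (F * (T powr (\<beta> + 1) / (\<beta> + 1)))"
proof -
  have "\<bar>integral {0..s} (\<lambda>x. x powr \<beta> * f (v x))\<bar> \<le> F * (s powr (\<beta> + 1) / (\<beta> + 1))"
    using assms by (intro integral_weight_bound continuous_on_subset[OF assms(1)]) auto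
  also have "\<dots> \<le> F * (T powr (\<beta> + 1) / (\<beta> + 1))"
    using assms \<beta> F_nonneg by (intro mult_left_mono divide_right_mono powr_mono2) auto
  finally have "\<bar>\<kappa>\<bar> * \<bar>integral {0..s} (\<lambda>x. x powr \<beta> * f (v x))\<bar> \<le> \<bar>\<kappa>\<bar> * (F * (T powr (\<beta> + 1) / (\<beta> + 1)))"
    by (intro mult_left_mono) auto
  then show ?thesis by (simp only: momentum_def abs_mult add_diff_cancel_left')
qed

lemma continuous_on_momentum:
  assumes "continuous_on {0..T} v" shows "continuous_on {0..T} (momentum A v)"
  unfolding momentum_def
  by (intro continuous_intros indefinite_integral_continuous_1 integrable_weight assms)

lemma continuous_on_velocity:
  assumes "continuous_on {0..T} v" shows "continuous_on {0..T} (\<lambda>s. spow (1 / P) (momentum A v s))"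
  using P by (intro continuous_on_spow continuous_on_momentum assms) auto

lemma velocity_bound:
  assumes "A \<in> {lo..hi}" "continuous_on {0..T} v" "s \<in> {0..T}"
  shows "\<bar>spow (1 / P) (momentum A v s)\<bar>
    \<le> (max \<bar>lo\<bar> \<bar>hi\<bar> + \<bar>\<kappa>\<bar> * (F * (T powr (\<beta> + 1) / (\<beta> + 1)))) powr (1 / P)"
  unfolding abs_spow using momentum_bound[OF assms(2,3), of A] assms(1) P
  by (intro powr_mono2) auto

lemma volterra_lipschitz:
  assumes "A \<in> {lo..hi}" "continuous_on {0..T} v" "s \<in> {0..T}" "t \<in> {0..T}"
  shows "\<bar>volterra A v s - volterra A v t\<bar>
    \<le> (max \<bar>lo\<bar> \<bar>hi\<bar> + \<bar>\<kappa>\<bar> * (F * (T powr (\<beta> + 1) / (\<beta> + 1)))) powr (1 / P) * \<bar>s - t\<bar>"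
    (is "_ \<le> ?M * _")
proof -
  have *: "\<bar>volterra A v s - volterra A v t\<bar> \<le> ?M * \<bar>s - t\<bar>"
    if st: "s \<in> {0..T}" "t \<in> {0..T}" "s \<le> t" for s t
  proof -
    have i: "(\<lambda>s. spow (1 / P) (momentum A v s)) integrable_on {a..b}" if "0 \<le> a" "b \<le> T" for a b
      using that by (intro integrable_continuous_real continuous_on_subset[OF continuous_on_velocity[OF assms(2)]]) auto
    have "volterra A v t - volterra A v s = integral {s..t} (\<lambda>s. spow (1 / P) (momentum A v s))"
      unfolding volterra_def
      using Henstock_Kurzweil_Integration.integral_combine[of 0 s t, OF _ _ i] st by simp
    also have "\<bar>\<dots>\<bar> \<le> ?M * (t - s)"
      unfolding real_norm_def[symmetric] using velocity_bound[OF assms(1,2)] st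
      by (intro integral_bound continuous_on_subset[OF continuous_on_velocity[OF assms(2)]]) auto
    finally show ?thesis using st by (simp add: abs_minus_commute)
  qed
  show ?thesis
  proof (cases "s \<le> t")
    case True then show ?thesis using * assms by blast
  next
    case False
    then show ?thesis using *[of t s] assms by (simp add: abs_minus_commute)
  qed
qed

lemma tendsto_momentum:
  assumes "As \<longlonglongrightarrow> A" "\<And>n. continuous_on {0..T} (us n)"
    "\<And>x. x \<in> {0..T} \<Longrightarrow> (\<lambda>n. us n x) \<longlonglongrightarrow> u x" "s \<in> {0..T}"
  shows "(\<lambda>n. momentum (As n) (us n) s) \<longlonglongrightarrow> momentum A u s"
proof -
  have "(\<lambda>n. integral {0..s} (\<lambda>x. x powr \<beta> * f (us n x))) \<longlonglongrightarrow> integral {0..s} (\<lambda>x. x powr \<beta> * f (u x))"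
  proof (rule dominated_convergence(2))
  show "(\<lambda>x. x powr \<beta> * f (us n x)) integrable_on {0..s}" for n
    using assms(4) by (intro integrable_weight continuous_on_subset[OF assms(2)]) auto
  show "(\<lambda>x. F * x powr \<beta>) integrable_on {0..s}"
    using has_integral_mult_right[OF has_integral_powr_from_0[OF \<beta>], of s F] assms(4)
    by (auto simp: integrable_on_def)
  show "norm (x powr \<beta> * f (us n x)) \<le> F * x powr \<beta>" for n x
    using weight_bound by simp
  show "(\<lambda>n. x powr \<beta> * f (us n x)) \<longlonglongrightarrow> x powr \<beta> * f (u x)" if "x \<in> {0..s}" for x
    using assms(3)[of x] assms(4) that cont_f
    by (intro tendsto_intros isCont_tendsto_compose[of _ f]) (auto simp: continuous_on_eq_continuous_at)
  qed
  then show ?thesis unfolding momentum_def by (intro tendsto_intros assms(1))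
qed

text \<open>
The weight $x^\<beta>$ may be unbounded at $0$, but it is integrable and \<open>f\<close> is bounded. This gives both the
Lipschitz constant and, by dominated convergence, continuity under pointwise limits.
\<close>

lemma causal_family_volterra:
  assumes "0 < T"
  shows "causal_family T lo hi C
    ((max \<bar>lo\<bar> \<bar>hi\<bar> + \<bar>\<kappa>\<bar> * (F * (T powr (\<beta> + 1) / (\<beta> + 1)))) powr (1 / P)) volterra"
proof
  fix t A and u v :: "real \<Rightarrow> real"
  assume "t \<in> {0..T}" and uv: "\<And>x. x \<in> {0..t} \<Longrightarrow> u x = v x"
  have "momentum A u s = momentum A v s" if "s \<in> {0..t}" for s
    using uv that unfolding momentum_def by (auto intro!: Henstock_Kurzweil_Integration.integral_cong)
  then show "volterra A u t = volterra A v t"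
    unfolding volterra_def by (auto intro!: Henstock_Kurzweil_Integration.integral_cong)
next
  fix As :: "nat \<Rightarrow> real" and A t u and us :: "nat \<Rightarrow> real \<Rightarrow> real"
  assume As: "\<And>n. As n \<in> {lo..hi}" "As \<longlonglongrightarrow> A" and us: "\<And>n. continuous_on {0..T} (us n)"
    and lim: "\<And>x. x \<in> {0..T} \<Longrightarrow> (\<lambda>n. us n x) \<longlonglongrightarrow> u x" and t: "t \<in> {0..T}"
  show "(\<lambda>n. volterra (As n) (us n) t) \<longlonglongrightarrow> volterra A u t"
    unfolding volterra_def
  proof (rule tendsto_add[OF tendsto_const], rule dominated_convergence(2))
    show "(\<lambda>s. spow (1 / P) (momentum (As n) (us n) s)) integrable_on {0..t}" for n
      using t by (intro integrable_continuous_real continuous_on_subset[OF continuous_on_velocity[OF us]]) auto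
    show "(\<lambda>n. spow (1 / P) (momentum (As n) (us n) s)) \<longlonglongrightarrow> spow (1 / P) (momentum A u s)"
      if "s \<in> {0..t}" for s
      using P t that by (intro tendsto_spow tendsto_momentum[OF As(2) us lim]) auto
    show "norm (spow (1 / P) (momentum (As n) (us n) s))
      \<le> (max \<bar>lo\<bar> \<bar>hi\<bar> + \<bar>\<kappa>\<bar> * (F * (T powr (\<beta> + 1) / (\<beta> + 1)))) powr (1 / P)"
      if "s \<in> {0..t}" for n s
      using velocity_bound[OF As(1) us] t that by auto
  qed auto
next
  fix A s t and v :: "real \<Rightarrow> real"
  assume "A \<in> {lo..hi}" "continuous_on {0..T} v" "s \<in> {0..T}" "t \<in> {0..T}"
  then show "\<bar>volterra A v s - volterra A v t\<bar>
    \<le> (max \<bar>lo\<bar> \<bar>hi\<bar> + \<bar>\<kappa>\<bar> * (F * (T powr (\<beta> + 1) / (\<beta> + 1)))) powr (1 / P) * \<bar>s - t\<bar>"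
    by (rule volterra_lipschitz)
qed (use assms in \<open>auto simp: volterra_def\<close>)

lemma fixed_point_flow:
  assumes u: "continuous_on {0..T} u" and fixp: "\<And>t. t \<in> {0..T} \<Longrightarrow> volterra A u t = u t"
  shows "flow P \<beta> \<kappa> f {0<..<T} u (momentum A u)"
  unfolding flow_def
proof (intro ballI conjI)
  fix t assume t: "t \<in> {0<..<T}"
  then have at: "at t within {0..T} = at t" by (intro at_within_Icc_at) auto
  have "(volterra A u has_real_derivative spow (1 / P) (momentum A u t)) (at t within {0..T})"
    unfolding volterra_def using t
    by (auto intro!: derivative_eq_intros integral_has_real_derivative continuous_on_velocity[OF u])
  then have "(u has_real_derivative spow (1 / P) (momentum A u t)) (at t within {0..T})"
    by (rule has_field_derivative_transform_within[where d = 1]) (use t fixp in auto)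
  then show "(u has_real_derivative spow (1 / P) (momentum A u t)) (at t)" by (simp add: at)
  have ut: "isCont u t"
    using u t by (intro continuous_on_interior[of "{0..T}"]) auto
  have "isCont (\<lambda>x. x powr \<beta> * f (u x)) t"
    using t cont_f by (intro continuous_intros ut isCont_o2[OF ut])
      (auto simp: continuous_on_eq_continuous_at)
  then have "continuous (at t within ({0..T} - {})) (\<lambda>x. x powr \<beta> * f (u x))"
    by (rule continuous_at_imp_continuous_at_within)
  from integral_has_vector_derivative_continuous_at[OF integrable_weight[OF u] _ _ this]
  have "((\<lambda>s. integral {0..s} (\<lambda>x. x powr \<beta> * f (u x))) has_real_derivative t powr \<beta> * f (u t)) (at t)"
    using t by (simp add: at has_real_derivative_iff_has_vector_derivative)
  from DERIV_add[OF DERIV_const DERIV_cmult[OF this]]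
  show "(momentum A u has_real_derivative \<kappa> * (t powr \<beta> * f (u t))) (at t)"
    unfolding momentum_def by simp
qed

lemma initial_value_problem:
  assumes "0 < T"
  obtains u z where "continuous_on {0..T} u" "continuous_on {0..T} z" "u 0 = C" "z 0 = A"
    "flow P \<beta> \<kappa> f {0<..<T} u z"
proof -
  obtain u where u: "continuous_on {0..T} u" "\<And>t. t \<in> {0..T} \<Longrightarrow> volterra A u t = u t"
    by (rule causal_family.fixed_point[OF causal_family_volterra[OF assms, of A A], of A]) auto
  have "u 0 = C" "momentum A u 0 = A"
    using u(2)[of 0] assms by (auto simp: volterra_def momentum_def)
  then show thesis
    using that[OF u(1) continuous_on_momentum[OF u(1)]] fixed_point_flow[OF u] by blast
qed

end

section \<open>Comparison\<close>

text \<open>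
A positive interior maximum of \<open>u1 - u2\<close> is impossible: there the derivatives agree, so \<open>z1 = z2\<close>, and
\<open>z1 - z2\<close> has positive derivative; immediately to the right \<open>z1 > z2\<close>, hence \<open>u1 - u2\<close> still increases.
\<close>

lemma comparison:
  fixes u1 u2 z1 z2 d1 d2 :: "real \<Rightarrow> real"
  assumes P: "0 < P"
    and cont: "continuous_on {0..T} u1" "continuous_on {0..T} u2"
    and ends: "u1 0 \<le> u2 0" "u1 T \<le> u2 T"
    and u1: "\<And>t. t \<in> {0<..<T} \<Longrightarrow> (u1 has_real_derivative spow (1 / P) (z1 t)) (at t)"
    and u2: "\<And>t. t \<in> {0<..<T} \<Longrightarrow> (u2 has_real_derivative spow (1 / P) (z2 t)) (at t)"
    and z1: "\<And>t. t \<in> {0<..<T} \<Longrightarrow> (z1 has_real_derivative d1 t) (at t)"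
    and z2: "\<And>t. t \<in> {0<..<T} \<Longrightarrow> (z2 has_real_derivative d2 t) (at t)"
    and gt: "\<And>t. t \<in> {0<..<T} \<Longrightarrow> u2 t < u1 t \<Longrightarrow> d2 t < d1 t"
    and t: "t \<in> {0..T}"
  shows "u1 t \<le> u2 t"
proof (rule ccontr)
  assume neg: "\<not> u1 t \<le> u2 t"
  define e where "e s = u1 s - u2 s" for s
  have "continuous_on {0..T} e" unfolding e_def using cont by (intro continuous_intros)
  from continuous_attains_sup[OF compact_Icc _ this] t
  obtain m where m: "m \<in> {0..T}" "\<And>s. s \<in> {0..T} \<Longrightarrow> e s \<le> e m" by auto
  have em: "0 < e m" using m(2)[OF t] neg by (simp add: e_def)
  then have "m \<noteq> 0" "m \<noteq> T" using ends by (auto simp: e_def)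
  with m have mI: "m \<in> {0<..<T}" by auto
  have de: "(e has_real_derivative spow (1 / P) (z1 s) - spow (1 / P) (z2 s)) (at s)"
    if "s \<in> {0<..<T}" for s
    unfolding e_def using that by (intro DERIV_diff u1 u2)
  have "spow (1 / P) (z1 m) - spow (1 / P) (z2 m) = 0"
  proof (rule DERIV_local_max[OF de[OF mI]])
    show "0 < min m (T - m)" using mI by auto
    show "\<forall>s. \<bar>m - s\<bar> < min m (T - m) \<longrightarrow> e s \<le> e m" by (auto intro!: m(2))
  qed
  then have zm: "z1 m = z2 m"
    using P spow_mono_strict[of "1 / P" "z1 m" "z2 m"] spow_mono_strict[of "1 / P" "z2 m" "z1 m"]
    by (metis diff_eq_eq add_0 less_irrefl linorder_neqE_linordered_idom zero_less_divide_1_iff)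
  have "((\<lambda>s. z1 s - z2 s) has_real_derivative d1 m - d2 m) (at m)"
    by (intro DERIV_diff z1 z2 mI)
  moreover have "0 < d1 m - d2 m" using gt[OF mI] em by (simp add: e_def)
  ultimately obtain \<delta> where \<delta>: "0 < \<delta>" "\<And>h. 0 < h \<Longrightarrow> h < \<delta> \<Longrightarrow> z1 m - z2 m < z1 (m + h) - z2 (m + h)"
    using DERIV_pos_inc_right by blast
  define b where "b = m + min \<delta> (T - m) / 2"
  have b: "m < b" "b < T" "b - m < \<delta>" using \<delta>(1) mI by (auto simp: b_def min_def field_simps)
  have "e m < e b"
  proof (rule DERIV_pos_imp_increasing_open[OF b(1)])
    fix s assume s: "m < s" "s < b"
    then have sI: "s \<in> {0<..<T}" using mI b by auto
    have "z2 s < z1 s" using \<delta>(2)[of "s - m"] s b zm by auto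
    then show "\<exists>y. (e has_real_derivative y) (at s) \<and> 0 < y"
      using de[OF sI] spow_mono_strict[of "1 / P" "z2 s" "z1 s"] P by auto
  next
    show "continuous_on {m..b} e" unfolding e_def
      using mI b by (intro continuous_intros continuous_on_subset[OF cont(1)] continuous_on_subset[OF cont(2)]) auto
  qed
  with m(2)[of b] b mI show False by auto
qed

definition truncated_power :: "real \<Rightarrow> real \<Rightarrow> real \<Rightarrow> real" where
  "truncated_power q C x = max 0 (min x C) powr q"

lemma truncated_power_eq: "0 \<le> x \<Longrightarrow> x \<le> C \<Longrightarrow> truncated_power q C x = x powr q"
  by (simp add: truncated_power_def)

lemma truncated_power_nonneg: "0 \<le> truncated_power q C x"
  by (simp add: truncated_power_def)

lemma truncated_power_bound: "0 \<le> q \<Longrightarrow> 0 \<le> C \<Longrightarrow> \<bar>truncated_power q C x\<bar> \<le> C powr q"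
  unfolding truncated_power_def by (auto intro!: powr_mono2)

lemma continuous_on_truncated_power: "0 < q \<Longrightarrow> continuous_on UNIV (truncated_power q C)"
  unfolding truncated_power_def by (intro continuous_on_powr' continuous_intros) auto

lemma truncated_power_gt: "0 < q \<Longrightarrow> 0 \<le> x \<Longrightarrow> x < C \<Longrightarrow> x < y \<Longrightarrow> x powr q < truncated_power q C y"
  unfolding truncated_power_def by (auto intro!: powr_less_mono2)

lemma truncated_power_less: "0 < q \<Longrightarrow> 0 < x \<Longrightarrow> y < x \<Longrightarrow> truncated_power q C y < x powr q"
  unfolding truncated_power_def by (auto intro!: powr_less_mono2)

lemma volterra_truncated_power:
  assumes "0 < P" "- 1 < \<beta>" "0 < q" "0 \<le> C"
  shows "volterra P \<beta> (C powr q) (truncated_power q C)"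
  using assms by unfold_locales (auto intro!: truncated_power_bound continuous_on_truncated_power)

section \<open>Barriers for the Emden--Fowler equation\<close>

text \<open>
The last two assumptions express that $a\,t^{-\<mu>}$ solves $(|u'|^{P-1}u')' = K t^\<beta> u^q$: the first one matches
the exponents and the second one the coefficients.
\<close>

locale emden_fowler =
  fixes P q \<beta> K a \<mu> :: real
  assumes P: "0 < P" and q: "P < q" and \<beta>: "- 1 < \<beta>" and K: "0 < K" and a: "0 < a"
    and \<mu>: "0 < \<mu>"
    and scaling: "\<mu> * (q - P) = \<beta> + P + 1"
    and amplitude: "K * a powr (q - P) = \<mu> powr P * P * (\<mu> + 1)"

locale emden_fowler_barriers = emden_fowler +
  fixes B :: real
  assumes B: "0 < B"
begin

text \<open>
\<open>B\<close> fixes the common value $a B^{-\<mu>}$ of all barriers at $0$; in this parametrisation the base of the power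
is the $\<theta>$-th power of an $\<ell>^\<theta>$-norm of $(t, B)$.
\<close>

definition barrier :: "real \<Rightarrow> real \<Rightarrow> real" where
  "barrier \<theta> t = a * (t powr \<theta> + B powr \<theta>) powr (- \<mu> / \<theta>)"

definition barrier_momentum :: "real \<Rightarrow> real \<Rightarrow> real" where
  "barrier_momentum \<theta> t = - ((a * \<mu>) powr P * (t powr ((\<theta> - 1) * P) *
     (t powr \<theta> + B powr \<theta>) powr (- (\<mu> / \<theta> + 1) * P)))"

text \<open>
The factor by which the derivative of the barrier's momentum differs from the right-hand side of the equation.
\<close>

definition defect :: "real \<Rightarrow> real \<Rightarrow> real" where
  "defect \<theta> t = (t powr \<theta> / (t powr \<theta> + B powr \<theta>)) powr (P + 1 - (\<beta> + P + 1) / \<theta>) *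
     (1 - (\<theta> - 1) / (\<mu> + 1) * B powr \<theta> / t powr \<theta>)"

lemma base_pos: "0 < t powr \<theta> + B powr \<theta>"
  using B by (intro add_nonneg_pos) auto

lemma has_derivative_barrier:
  assumes t: "0 < t" and \<theta>: "0 < \<theta>"
  shows "(barrier \<theta> has_real_derivative spow (1 / P) (barrier_momentum \<theta> t)) (at t)"
proof -
  define D where "D = t powr \<theta> + B powr \<theta>"
  have D: "0 < D" unfolding D_def by (rule base_pos)
  have "(barrier \<theta> has_real_derivative
      a * ((- \<mu> / \<theta>) * D powr (- \<mu> / \<theta> - 1) * (\<theta> * t powr (\<theta> - 1)))) (at t)"
    unfolding barrier_def D_def using t \<theta> D[unfolded D_def] by (auto intro!: derivative_eq_intros)
  moreover have "spow (1 / P) (barrier_momentum \<theta> t) =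
      a * ((- \<mu> / \<theta>) * D powr (- \<mu> / \<theta> - 1) * (\<theta> * t powr (\<theta> - 1)))"
  proof -
    have "spow (1 / P) (barrier_momentum \<theta> t) =
        - (((a * \<mu>) powr P * (t powr ((\<theta> - 1) * P) * D powr (- (\<mu> / \<theta> + 1) * P))) powr (1 / P))"
      unfolding barrier_momentum_def D_def[symmetric] spow_minus
      using a \<mu> t D by (subst spow_pos) auto
    also have "\<dots> = - (a * \<mu> * (t powr (\<theta> - 1) * D powr (- (\<mu> / \<theta> + 1))))"
      using a \<mu> P by (simp add: powr_mult powr_powr)
    finally show ?thesis using \<theta> by (simp add: mult_ac)
  qed
  ultimately show ?thesis by simp
qed

lemma has_derivative_barrier_momentum:
  assumes t: "0 < t" and \<theta>: "0 < \<theta>"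
  shows "(barrier_momentum \<theta> has_real_derivative K * (t powr \<beta> * barrier \<theta> t powr q) * defect \<theta> t) (at t)"
proof -
  define b where "b = B powr \<theta>"
  define D where "D = t powr \<theta> + b"
  define s where "s = t powr \<theta>"
  define X where "X = (a * \<mu>) powr P"
  define e where "e = - (\<mu> / \<theta> + 1) * P"
  have s: "0 < s" and D: "0 < D" "D = s + b" using t B by (auto simp: D_def b_def s_def add_pos_pos)
  have "(barrier_momentum \<theta> has_real_derivative
      - (X * (((\<theta> - 1) * P * t powr ((\<theta> - 1) * P - 1)) * D powr e +
         t powr ((\<theta> - 1) * P) * (e * D powr (e - 1) * (\<theta> * t powr (\<theta> - 1)))))) (at t)"
    unfolding barrier_momentum_def D_def X_def e_def b_def
    using t D[unfolded D_def b_def] by (auto intro!: derivative_eq_intros)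
  also have "- (X * (((\<theta> - 1) * P * t powr ((\<theta> - 1) * P - 1)) * D powr e +
         t powr ((\<theta> - 1) * P) * (e * D powr (e - 1) * (\<theta> * t powr (\<theta> - 1))))) =
      X * P * (\<mu> + 1) * (t powr ((\<theta> - 1) * P - 1) * D powr (e - 1)) * (s - (\<theta> - 1) / (\<mu> + 1) * b)"
  proof -
    have 1: "D powr e = D powr (e - 1) * D" using D by (simp add: powr_diff)
    have 2: "t powr ((\<theta> - 1) * P) * t powr (\<theta> - 1) = t powr ((\<theta> - 1) * P - 1) * s"
      unfolding s_def powr_add[symmetric] by (simp add: algebra_simps)
    have 3: "e * \<theta> = - (\<mu> + \<theta>) * P" using \<theta> by (simp add: e_def field_simps)
    have 4: "(\<mu> + 1) * (s - (\<theta> - 1) / (\<mu> + 1) * b) = (\<mu> + 1) * s - (\<theta> - 1) * b"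
      using \<mu> by (simp add: field_simps)
    have "- (X * (((\<theta> - 1) * P * t powr ((\<theta> - 1) * P - 1)) * D powr e +
         t powr ((\<theta> - 1) * P) * (e * D powr (e - 1) * (\<theta> * t powr (\<theta> - 1))))) =
      - (X * ((\<theta> - 1) * P * t powr ((\<theta> - 1) * P - 1) * D powr e +
         (e * \<theta>) * D powr (e - 1) * (t powr ((\<theta> - 1) * P) * t powr (\<theta> - 1))))"
      by (simp add: algebra_simps)
    also have "\<dots> = X * P * (t powr ((\<theta> - 1) * P - 1) * D powr (e - 1)) * ((\<mu> + 1) * s - (\<theta> - 1) * b)"
      unfolding 1 2 3 by (simp add: D(2) algebra_simps)
    finally show ?thesis unfolding 4[symmetric] by (simp add: mult_ac)
  qed
  also have "\<dots> = K * (t powr \<beta> * barrier \<theta> t powr q) * defect \<theta> t"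
  proof -
    define E where "E = (\<beta> + P + 1) / \<theta>"
    have Ka: "K * a powr q = X * P * (\<mu> + 1)"
    proof -
      have "K * a powr q = (K * a powr (q - P)) * a powr P" using a by (simp add: powr_add[symmetric])
      then show ?thesis unfolding amplitude X_def using a \<mu> by (simp add: powr_mult mult_ac)
    qed
    have bar: "barrier \<theta> t powr q = a powr q * D powr (- \<mu> * q / \<theta>)"
      unfolding barrier_def D_def b_def using a by (simp add: powr_mult powr_powr)
    have def: "defect \<theta> t = t powr (\<theta> * (P + 1 - E)) * D powr (- (P + 1 - E)) * (1 - (\<theta> - 1) / (\<mu> + 1) * b / s)"
    proof -
      have "(t powr \<theta> / D) powr (P + 1 - E) = t powr (\<theta> * (P + 1 - E)) * D powr (- (P + 1 - E))"
        using t D by (simp only: powr_divide powr_powr powr_minus_divide) simp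
      then show ?thesis unfolding defect_def E_def D_def s_def b_def by simp
    qed
    have t_exp: "t powr \<beta> * t powr (\<theta> * (P + 1 - E)) = t powr ((\<theta> - 1) * P - 1) * s"
    proof -
      have "\<theta> * E = \<beta> + P + 1" using \<theta> by (simp add: E_def)
      then have "\<beta> + \<theta> * (P + 1 - E) = (\<theta> - 1) * P - 1 + \<theta>" by (simp add: algebra_simps)
      then show ?thesis by (simp only: s_def powr_add[symmetric])
    qed
    have E': "E = \<mu> * (q - P) / \<theta>" by (simp add: E_def scaling)
    have "- \<mu> * q / \<theta> + - (P + 1 - E) = e - 1"
      unfolding E' e_def using \<theta> by (simp add: field_simps)
    then have D_exp: "D powr (- \<mu> * q / \<theta>) * D powr (- (P + 1 - E)) = D powr (e - 1)"
      by (simp only: powr_add[symmetric])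
    have "K * (t powr \<beta> * barrier \<theta> t powr q) * defect \<theta> t =
       (K * a powr q) * (t powr \<beta> * t powr (\<theta> * (P + 1 - E))) *
       (D powr (- \<mu> * q / \<theta>) * D powr (- (P + 1 - E))) * (1 - (\<theta> - 1) / (\<mu> + 1) * b / s)"
      unfolding bar def by (simp only: mult_ac)
    also have "\<dots> = X * P * (\<mu> + 1) * (t powr ((\<theta> - 1) * P - 1) * D powr (e - 1)) * (s * (1 - (\<theta> - 1) / (\<mu> + 1) * b / s))"
      unfolding Ka t_exp D_exp by (simp only: mult_ac)
    also have "s * (1 - (\<theta> - 1) / (\<mu> + 1) * b / s) = s - (\<theta> - 1) / (\<mu> + 1) * b"
      using s by (simp add: right_diff_distrib)
    finally show ?thesis by simp
  qed
  finally show ?thesis .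
qed

text \<open>
The barrier is a supersolution when both factors of the defect are at most $1$, which happens for \<open>\<theta> \<ge> 1\<close> and
\<open>\<theta> \<ge> (\<beta> + P + 1) / (P + 1)\<close>. The reversed inequalities give a subsolution.
\<close>

lemma defect_le_1:
  assumes "0 < t" "1 \<le> \<theta>" "\<beta> + P + 1 \<le> \<theta> * (P + 1)"
  shows "defect \<theta> t \<le> 1"
proof -
  define x where "x = t powr \<theta> / (t powr \<theta> + B powr \<theta>)"
  define y where "y = (\<theta> - 1) / (\<mu> + 1) * B powr \<theta> / t powr \<theta>"
  have x: "0 \<le> x" "x \<le> 1" using assms B by (auto simp: x_def field_simps add_pos_pos)
  have y: "0 \<le> y" using assms \<mu> B by (simp add: y_def)
  have "0 \<le> P + 1 - (\<beta> + P + 1) / \<theta>" using assms by (simp add: field_simps)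
  then have z: "x powr (P + 1 - (\<beta> + P + 1) / \<theta>) \<le> 1" using x by (intro powr_le1) auto
  have "x powr (P + 1 - (\<beta> + P + 1) / \<theta>) * (1 - y) \<le> x powr (P + 1 - (\<beta> + P + 1) / \<theta>) * 1"
    using y by (intro mult_left_mono) auto
  with z show ?thesis by (simp add: defect_def x_def y_def)
qed

lemma defect_ge_1:
  assumes "0 < t" "0 < \<theta>" "\<theta> \<le> 1" "\<theta> * (P + 1) \<le> \<beta> + P + 1"
  shows "1 \<le> defect \<theta> t"
proof -
  define x where "x = t powr \<theta> / (t powr \<theta> + B powr \<theta>)"
  define y where "y = (\<theta> - 1) / (\<mu> + 1) * B powr \<theta> / t powr \<theta>"
  have x: "0 < x" "x \<le> 1" using assms B by (auto simp: x_def field_simps add_pos_pos)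
  have y: "y \<le> 0" using assms \<mu> B by (auto simp: y_def intro!: divide_nonpos_nonneg mult_nonpos_nonneg)
  have e: "P + 1 - (\<beta> + P + 1) / \<theta> \<le> 0" using assms by (simp add: field_simps)
  have z: "1 \<le> x powr (P + 1 - (\<beta> + P + 1) / \<theta>)" using powr_mono'[OF e, of x] x by auto
  have "1 * 1 \<le> x powr (P + 1 - (\<beta> + P + 1) / \<theta>) * (1 - y)"
    using y z by (intro mult_mono) auto
  then show ?thesis by (simp add: defect_def x_def y_def)
qed

lemma barrier_pos: "0 < barrier \<theta> t"
  using a base_pos[of t \<theta>] by (simp add: barrier_def)

lemma barrier_0: "0 < \<theta> \<Longrightarrow> barrier \<theta> 0 = a * B powr (- \<mu>)"
  using B by (simp add: barrier_def powr_powr)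

lemma barrier_less: "0 < \<theta> \<Longrightarrow> 0 < t \<Longrightarrow> barrier \<theta> t < a * B powr (- \<mu>)"
  unfolding barrier_0[symmetric] using a \<mu> B
  by (auto simp: barrier_def divide_neg_pos intro!: powr_less_mono2_neg)

lemma continuous_on_barrier: "0 < \<theta> \<Longrightarrow> continuous_on {0..} (barrier \<theta>)"
  unfolding barrier_def using B
  by (intro continuous_intros continuous_on_powr') (auto simp: add_nonneg_pos add_nonneg_eq_0_iff)

lemma tendsto_barrier_ratio:
  assumes "0 < \<theta>" shows "((\<lambda>t. barrier \<theta> t / (a * t powr (- \<mu>))) \<longlongrightarrow> 1) at_top"
proof -
  have "((\<lambda>t. (1 + (B / t) powr \<theta>) powr (- \<mu> / \<theta>)) \<longlongrightarrow> (1 + 0) powr (- \<mu> / \<theta>)) at_top"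
  proof (intro tendsto_powr tendsto_add tendsto_const)
    show "((\<lambda>t. (B / t) powr \<theta>) \<longlongrightarrow> 0) at_top" using assms B by real_asymp
  qed simp
  moreover have "(1 + (B / t) powr \<theta>) powr (- \<mu> / \<theta>) = barrier \<theta> t / (a * t powr (- \<mu>))" if "0 < t" for t
  proof -
    have "t powr \<theta> + B powr \<theta> = t powr \<theta> * (1 + (B / t) powr \<theta>)"
      using that B by (simp add: powr_divide field_simps)
    then have "barrier \<theta> t = a * (t powr (- \<mu>) * (1 + (B / t) powr \<theta>) powr (- \<mu> / \<theta>))"
      unfolding barrier_def using assms by (simp add: powr_mult powr_powr)
    then show ?thesis using a that by simp
  qed
  ultimately show ?thesis
    by (auto elim!: Lim_transform_eventually intro: eventually_mono[OF eventually_gt_at_top[of 0]])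
qed

text \<open>
The $\<ell>^\<theta>$-norm of $(t, B)$ decreases as \<open>\<theta>\<close> grows: after division by the norm \<open>S\<close> for \<open>\<theta>2\<close> both
components are at most $1$, so lowering the exponent increases their powers.
\<close>

lemma barrier_mono:
  assumes "0 < \<theta>1" "\<theta>1 \<le> \<theta>2" "0 < t"
  shows "barrier \<theta>1 t \<le> barrier \<theta>2 t"
proof -
  define S where "S = (t powr \<theta>2 + B powr \<theta>2) powr (1 / \<theta>2)"
  have S: "0 < S" using base_pos[of t \<theta>2] by (simp add: S_def)
  have S2: "S powr \<theta>2 = t powr \<theta>2 + B powr \<theta>2" using assms base_pos[of t \<theta>2] by (simp add: S_def powr_powr)
  have le: "(y / S) powr \<theta>2 \<le> (y / S) powr \<theta>1" if "y \<in> {t, B}" for y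
  proof -
    have y: "0 < y" using that assms B by auto
    have "y powr \<theta>2 \<le> S powr \<theta>2" unfolding S2 using that by auto
    then have "y \<le> S" using y S assms powr_less_mono2[of \<theta>2 S y] by (meson not_le less_le_trans less_imp_le)
    then show ?thesis using y S assms by (intro powr_mono') auto
  qed
  have "1 = (t / S) powr \<theta>2 + (B / S) powr \<theta>2"
    using S assms B S2 base_pos[of t \<theta>2] by (simp add: powr_divide add_divide_distrib[symmetric])
  also have "\<dots> \<le> (t / S) powr \<theta>1 + (B / S) powr \<theta>1" by (intro add_mono le) auto
  also have "\<dots> = (t powr \<theta>1 + B powr \<theta>1) / S powr \<theta>1"
    using S assms B by (simp add: powr_divide add_divide_distrib)
  finally have "S powr \<theta>1 \<le> t powr \<theta>1 + B powr \<theta>1" using S by simp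
  then have "(t powr \<theta>1 + B powr \<theta>1) powr (- \<mu> / \<theta>1) \<le> (S powr \<theta>1) powr (- \<mu> / \<theta>1)"
    using S \<mu> assms by (intro powr_mono2') auto
  also have "\<dots> = (t powr \<theta>2 + B powr \<theta>2) powr (- \<mu> / \<theta>2)"
    using assms by (simp add: S_def powr_powr)
  finally show ?thesis unfolding barrier_def using a by simp
qed

end

section \<open>A global solution between two barriers\<close>

context volterra
begin

text \<open>
The bound on \<open>A\<close> keeps the velocity below \<open>- C / T\<close>. It provides the lower end for the shooting, and, read
backwards on \<open>{0..1}\<close>, a lower bound for the parameter of every solution that is still positive at $1$.
\<close>

lemma volterra_nonpos:
  assumes T: "0 < T" and C: "0 \<le> C" and v: "continuous_on {0..T} v"
    and A: "A \<le> - (\<bar>\<kappa>\<bar> * (F * (T powr (\<beta> + 1) / (\<beta> + 1))) + (C / T) powr P)"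
  shows "volterra A v T \<le> 0"
proof -
  have "integral {0..T} (\<lambda>s. spow (1 / P) (momentum A v s)) \<le> integral {0..T} (\<lambda>s. - (C / T))"
  proof (rule integral_le)
    show "(\<lambda>s. spow (1 / P) (momentum A v s)) integrable_on {0..T}"
      by (intro integrable_continuous_real continuous_on_velocity v)
    fix s assume "s \<in> {0..T}"
    from momentum_bound[OF v this, of A] A have "momentum A v s \<le> - ((C / T) powr P)" by linarith
    then have "spow (1 / P) (momentum A v s) \<le> spow (1 / P) (- ((C / T) powr P))"
      using P by (intro spow_mono) auto
    also have "\<dots> = - (C / T)"
      using T C P by (cases "C = 0") (auto simp: spow_minus spow_pos powr_powr)
    finally show "spow (1 / P) (momentum A v s) \<le> - (C / T)" .
  qed auto
  then show ?thesis using T by (simp add: volterra_def)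
qed

lemma volterra_ge_start:
  assumes \<kappa>: "0 \<le> \<kappa>" and f: "\<And>x. 0 \<le> f x" and v: "continuous_on {0..T} v" and t: "t \<in> {0..T}"
  shows "C \<le> volterra 0 v t"
proof -
  have "0 \<le> spow (1 / P) (momentum 0 v s)" if "s \<in> {0..t}" for s
  proof -
    have "0 \<le> integral {0..s} (\<lambda>x. x powr \<beta> * f (v x))"
      using that t f by (intro integral_nonneg integrable_weight continuous_on_subset[OF v]) auto
    then show ?thesis using \<kappa> P spow_mono[of "1 / P" 0] by (simp add: momentum_def)
  qed
  then have "0 \<le> integral {0..t} (\<lambda>s. spow (1 / P) (momentum 0 v s))"
    using t by (intro integral_nonneg integrable_continuous_real
        continuous_on_subset[OF continuous_on_velocity[OF v]]) auto
  then show ?thesis by (simp add: volterra_def)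
qed

end

context emden_fowler_barriers
begin

definition initial_value :: real where
  "initial_value = a * B powr (- \<mu>)"

lemma initial_value_pos: "0 < initial_value"
  using a B by (simp add: initial_value_def)

sublocale clipped: volterra P \<beta> K "initial_value powr q" initial_value "truncated_power q initial_value"
  using volterra_truncated_power[OF P \<beta>, of q initial_value] P q initial_value_pos by simp

text \<open>
The two exponents are the extreme ones that the defect estimates allow; they agree only for \<open>\<beta> = 0\<close>, where
the barrier is an exact solution.
\<close>

definition \<theta>_low :: real where "\<theta>_low = min 1 ((\<beta> + P + 1) / (P + 1))"

definition \<theta>_high :: real where "\<theta>_high = max 1 ((\<beta> + P + 1) / (P + 1))"

lemma \<theta>_low: "0 < \<theta>_low" "\<theta>_low \<le> 1" "\<theta>_low * (P + 1) \<le> \<beta> + P + 1"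
proof -
  have "\<theta>_low \<le> (\<beta> + P + 1) / (P + 1)" by (simp add: \<theta>_low_def)
  then show "\<theta>_low * (P + 1) \<le> \<beta> + P + 1" using P by (simp add: pos_le_divide_eq)
qed (use P \<beta> in \<open>auto simp: \<theta>_low_def\<close>)

lemma \<theta>_high: "0 < \<theta>_high" "1 \<le> \<theta>_high" "\<beta> + P + 1 \<le> \<theta>_high * (P + 1)"
proof -
  have "(\<beta> + P + 1) / (P + 1) \<le> \<theta>_high" by (simp add: \<theta>_high_def)
  then show "\<beta> + P + 1 \<le> \<theta>_high * (P + 1)" using P by (simp add: pos_divide_le_eq)
qed (auto simp: \<theta>_high_def)

lemma weight_le_barrier_high:
  assumes "0 < t"
  shows "K * (t powr \<beta> * barrier \<theta>_high t powr q) * defect \<theta>_high t \<le> K * (t powr \<beta> * barrier \<theta>_high t powr q)"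
  using mult_left_mono[OF defect_le_1[OF assms \<theta>_high(2,3)], of "K * (t powr \<beta> * barrier \<theta>_high t powr q)"] K
  by simp

lemma weight_ge_barrier_low:
  assumes "0 < t"
  shows "K * (t powr \<beta> * barrier \<theta>_low t powr q) \<le> K * (t powr \<beta> * barrier \<theta>_low t powr q) * defect \<theta>_low t"
  using mult_left_mono[OF defect_ge_1[OF assms \<theta>_low], of "K * (t powr \<beta> * barrier \<theta>_low t powr q)"] K
  by simp

text \<open>
At the right end the solution takes the value of the upper barrier. A solution trapped on a longer interval does
not exceed the barrier at that point, so it is the smaller of the two on the common interval.
\<close>

definition trapped :: "real \<Rightarrow> real \<Rightarrow> (real \<Rightarrow> real) \<Rightarrow> bool" where
  "trapped T A u \<longleftrightarrow> 0 < T \<and> A \<le> 0 \<and> continuous_on {0..T} u \<and>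
     (\<forall>t\<in>{0..T}. clipped.volterra A u t = u t) \<and> u T = barrier \<theta>_high T"

lemma trapped_0: "trapped T A u \<Longrightarrow> u 0 = initial_value"
  by (auto simp: trapped_def clipped.volterra_def dest!: bspec[of _ _ 0])

lemma trapped_flow:
  assumes "trapped T A u"
  shows "flow P \<beta> K (truncated_power q initial_value) {0<..<T} u (clipped.momentum A u)"
  using assms by (intro clipped.fixed_point_flow) (auto simp: trapped_def)

lemma trapped_le:
  assumes u: "trapped T A u" and t: "t \<in> {0..T}"
  shows "u t \<le> barrier \<theta>_high t"
proof (rule comparison[OF P _ _ _ _ _ _ _ _ _ t])
  show "continuous_on {0..T} u" "u T \<le> barrier \<theta>_high T" using u by (auto simp: trapped_def)
  show "continuous_on {0..T} (barrier \<theta>_high)"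
    by (rule continuous_on_subset[OF continuous_on_barrier]) (use \<theta>_high in auto)
  show "u 0 \<le> barrier \<theta>_high 0" by (simp add: trapped_0[OF u] barrier_0 \<theta>_high initial_value_def)
  fix s assume s: "s \<in> {0<..<T}"
  show "(u has_real_derivative spow (1 / P) (clipped.momentum A u s)) (at s)"
    "(clipped.momentum A u has_real_derivative K * (s powr \<beta> * truncated_power q initial_value (u s))) (at s)"
    using trapped_flow[OF u] s by (auto simp: flow_def)
  show "(barrier \<theta>_high has_real_derivative spow (1 / P) (barrier_momentum \<theta>_high s)) (at s)"
    "(barrier_momentum \<theta>_high has_real_derivative
      K * (s powr \<beta> * barrier \<theta>_high s powr q) * defect \<theta>_high s) (at s)"
    using s \<theta>_high(1) by (auto intro: has_derivative_barrier has_derivative_barrier_momentum)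
  assume less: "barrier \<theta>_high s < u s"
  have "barrier \<theta>_high s powr q < truncated_power q initial_value (u s)"
    using less barrier_less[OF \<theta>_high(1), of s] barrier_pos[of \<theta>_high s] P q s
    by (intro truncated_power_gt) (auto simp: initial_value_def)
  then have "K * (s powr \<beta> * barrier \<theta>_high s powr q) < K * (s powr \<beta> * truncated_power q initial_value (u s))"
    using K s by simp
  with weight_le_barrier_high[of s] s
  show "K * (s powr \<beta> * barrier \<theta>_high s powr q) * defect \<theta>_high s
    < K * (s powr \<beta> * truncated_power q initial_value (u s))" by auto
qed

lemma trapped_ge:
  assumes u: "trapped T A u" and t: "t \<in> {0..T}"
  shows "barrier \<theta>_low t \<le> u t"
proof (rule comparison[OF P _ _ _ _ _ _ _ _ _ t])
  show "continuous_on {0..T} u" using u by (auto simp: trapped_def)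
  show "continuous_on {0..T} (barrier \<theta>_low)"
    by (rule continuous_on_subset[OF continuous_on_barrier]) (use \<theta>_low in auto)
  show "barrier \<theta>_low 0 \<le> u 0" by (simp add: trapped_0[OF u] barrier_0 \<theta>_low initial_value_def)
  have "\<theta>_low \<le> \<theta>_high" using \<theta>_low \<theta>_high by linarith
  from barrier_mono[OF \<theta>_low(1) this] show "barrier \<theta>_low T \<le> u T" using u by (simp add: trapped_def)
  fix s assume s: "s \<in> {0<..<T}"
  show "(barrier \<theta>_low has_real_derivative spow (1 / P) (barrier_momentum \<theta>_low s)) (at s)"
    "(barrier_momentum \<theta>_low has_real_derivative
      K * (s powr \<beta> * barrier \<theta>_low s powr q) * defect \<theta>_low s) (at s)"
    using s \<theta>_low(1) by (auto intro: has_derivative_barrier has_derivative_barrier_momentum)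
  show "(u has_real_derivative spow (1 / P) (clipped.momentum A u s)) (at s)"
    "(clipped.momentum A u has_real_derivative K * (s powr \<beta> * truncated_power q initial_value (u s))) (at s)"
    using trapped_flow[OF u] s by (auto simp: flow_def)
  assume "u s < barrier \<theta>_low s"
  then have "truncated_power q initial_value (u s) < barrier \<theta>_low s powr q"
    using barrier_pos[of \<theta>_low s] P q by (intro truncated_power_less) auto
  then have "K * (s powr \<beta> * truncated_power q initial_value (u s)) < K * (s powr \<beta> * barrier \<theta>_low s powr q)"
    using K s by simp
  with weight_ge_barrier_low[of s] s
  show "K * (s powr \<beta> * truncated_power q initial_value (u s))
    < K * (s powr \<beta> * barrier \<theta>_low s powr q) * defect \<theta>_low s" by auto
qed

lemma trapped_antimono:
  assumes u: "trapped T A u" and u': "trapped T' A' u'" and TT': "T \<le> T'" and t: "t \<in> {0..T}"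
  shows "u' t \<le> u t"
proof (rule comparison[OF P _ _ _ _ _ _ _ _ _ t])
  show "continuous_on {0..T} u" using u by (auto simp: trapped_def)
  show "continuous_on {0..T} u'"
    by (rule continuous_on_subset[of "{0..T'}"]) (use u' TT' in \<open>auto simp: trapped_def\<close>)
  show "u' 0 \<le> u 0" by (simp add: trapped_0[OF u] trapped_0[OF u'])
  show "u' T \<le> u T" using trapped_le[OF u', of T] u TT' by (auto simp: trapped_def)
  fix s assume s: "s \<in> {0<..<T}"
  show "(u' has_real_derivative spow (1 / P) (clipped.momentum A' u' s)) (at s)"
    "(clipped.momentum A' u' has_real_derivative K * (s powr \<beta> * truncated_power q initial_value (u' s))) (at s)"
    using trapped_flow[OF u'] s TT' by (auto simp: flow_def)
  show "(u has_real_derivative spow (1 / P) (clipped.momentum A u s)) (at s)"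
    "(clipped.momentum A u has_real_derivative K * (s powr \<beta> * truncated_power q initial_value (u s))) (at s)"
    using trapped_flow[OF u] s by (auto simp: flow_def)
  assume less: "u s < u' s"
  have "0 < u s" using trapped_ge[OF u, of s] barrier_pos[of \<theta>_low s] s by auto
  moreover have "u' s < initial_value"
    using trapped_le[OF u', of s] barrier_less[OF \<theta>_high(1), of s] s TT' by (auto simp: initial_value_def)
  ultimately have "truncated_power q initial_value (u s) < truncated_power q initial_value (u' s)"
    using less P q truncated_power_gt[of q "u s" initial_value "u' s"]
    by (simp add: truncated_power_eq[of "u s" initial_value])
  then show "K * (s powr \<beta> * truncated_power q initial_value (u s)) < K * (s powr \<beta> * truncated_power q initial_value (u' s))"
    using K s by simp
qed

definition slope_bound :: "real \<Rightarrow> real" where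
  "slope_bound T = - (\<bar>K\<bar> * (initial_value powr q * (T powr (\<beta> + 1) / (\<beta> + 1))) + (initial_value / T) powr P)"

lemma ex_trapped:
  assumes T: "0 < T" shows "\<exists>A u. trapped T A u"
proof -
  have le: "slope_bound T \<le> 0"
  proof -
    have "0 \<le> \<beta> + 1" using \<beta> by simp
    then show ?thesis unfolding slope_bound_def neg_le_0_iff_le
      by (intro add_nonneg_nonneg[OF mult_nonneg_nonneg[OF _ mult_nonneg_nonneg[OF _ divide_nonneg_nonneg]]]) simp_all
  qed
  obtain A u where "A \<in> {slope_bound T..0}" "continuous_on {0..T} u"
      "\<And>t. t \<in> {0..T} \<Longrightarrow> clipped.volterra A u t = u t" "u T = barrier \<theta>_high T"
  proof (rule causal_family.fixed_point_boundary_value[OF clipped.causal_family_volterra[OF T] le])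
    fix u :: "real \<Rightarrow> real" assume u: "continuous_on {0..T} u"
    have "clipped.volterra (slope_bound T) u T \<le> 0"
      using u T initial_value_pos by (intro clipped.volterra_nonpos) (auto simp: slope_bound_def)
    also have "0 \<le> barrier \<theta>_high T" using barrier_pos less_imp_le by blast
    finally show "clipped.volterra (slope_bound T) u T \<le> barrier \<theta>_high T" .
    have "barrier \<theta>_high T \<le> initial_value"
      using barrier_less[OF \<theta>_high(1) T] by (simp add: initial_value_def)
    also have "\<dots> \<le> clipped.volterra 0 u T"
      using T K u by (intro clipped.volterra_ge_start) (auto intro: truncated_power_nonneg)
    finally show "barrier \<theta>_high T \<le> clipped.volterra 0 u T" .
  qed (use that in blast)
  then have "trapped T A u" using T by (auto simp: trapped_def)
  then show ?thesis by blast
qed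

lemma trapped_slope_bound:
  assumes u: "trapped T A u" and T: "1 \<le> T" shows "A \<in> {slope_bound 1..0}"
proof -
  have c: "continuous_on {0..1} u"
    by (rule continuous_on_subset[of "{0..T}"]) (use u T in \<open>auto simp: trapped_def\<close>)
  have "0 < u 1" using trapped_ge[OF u, of 1] barrier_pos[of \<theta>_low 1] T by auto
  moreover have "clipped.volterra A u 1 = u 1" using u T by (simp add: trapped_def)
  moreover have "clipped.volterra A u 1 \<le> 0" if "A \<le> slope_bound 1"
    using that initial_value_pos c by (intro clipped.volterra_nonpos) (auto simp: slope_bound_def)
  ultimately show ?thesis using u by (fastforce simp: trapped_def)
qed

text \<open>
The trapped solutions on \<open>{0..n+1}\<close> decrease with \<open>n\<close>, so they converge pointwise; their parameters stay in a
compact interval, which gives a uniform Lipschitz bound on each \<open>{0..T}\<close> and lets the Volterra equation pass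
to the limit. The parameter of the limit is negative because a solution with parameter $0$ would stay above its
initial value, while the upper barrier falls below it.
\<close>

theorem decaying_solution:
  obtains A u z where "A < 0"
    "continuous_on {0..1} u" "u 0 = initial_value" "continuous_on {0..1} z" "z 0 = A"
    "flow P \<beta> K (\<lambda>x. x powr q) {0<..} u z"
    "\<And>t. 0 < t \<Longrightarrow> barrier \<theta>_low t \<le> u t" "\<And>t. 0 < t \<Longrightarrow> u t \<le> barrier \<theta>_high t"
proof -
  obtain As us where tr: "\<And>n. trapped (real n + 1) (As n) (us n)"
  proof -
    have "\<forall>n. \<exists>A u. trapped (real n + 1) A u" by (intro allI ex_trapped) simp
    then show thesis using that by metis
  qed
  have As: "As n \<in> {slope_bound 1..0}" for n
    by (rule trapped_slope_bound[OF tr]) simp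
  obtain A k where A: "A \<in> {slope_bound 1..0}" and k: "strict_mono (k :: nat \<Rightarrow> nat)"
      and Ak: "(As \<circ> k) \<longlonglongrightarrow> A"
    using As compact_Icc[of "slope_bound 1" 0] unfolding compact_def by metis
  have k_ge: "n \<le> k n" for n using strict_mono_imp_increasing[OF k] .
  define u where "u t = lim (\<lambda>n. us n t)" for t
  have lim_u: "(\<lambda>n. us n t) \<longlonglongrightarrow> u t" if "0 \<le> t" for t
  proof -
    define N where "N = nat \<lceil>t\<rceil>"
    have N: "t \<le> real n + 1" if "N \<le> n" for n using that by (simp add: N_def)
    have N': "t \<le> real n + real N + 1" for n using N[of "n + N"] by simp
    have "convergent (\<lambda>n. us (n + N) t)"
    proof (rule decseq_convergent[of _ "barrier \<theta>_low t"])
      show "decseq (\<lambda>n. us (n + N) t)"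
        unfolding decseq_Suc_iff using N' \<open>0 \<le> t\<close>
        by (auto intro!: trapped_antimono[OF tr tr])
      show "\<forall>n. barrier \<theta>_low t \<le> us (n + N) t"
        using N' \<open>0 \<le> t\<close> by (auto intro!: trapped_ge[OF tr])
    qed (auto simp: convergent_def)
    then have "convergent (\<lambda>n. us n t)"
      using convergent_ignore_initial_segment[of "\<lambda>n. us n t" N] by simp
    then show ?thesis unfolding u_def by (simp add: convergent_LIMSEQ_iff)
  qed
  have *: "continuous_on {0..T} u \<and> (\<forall>t\<in>{0..T}. clipped.volterra A u t = u t)" if T: "0 < T" for T
  proof -
    define N where "N = nat \<lceil>T\<rceil>"
    define j where "j n = k (n + N)" for n
    have j: "T \<le> real (j n) + 1" for n
      using k_ge[of "n + N"] by (simp add: j_def N_def) linarith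
    have sub: "strict_mono j" using k by (auto simp: j_def strict_mono_def)
    have Aj: "(\<lambda>n. As (j n)) \<longlonglongrightarrow> A"
      using LIMSEQ_ignore_initial_segment[OF Ak, of N] by (simp add: j_def o_def)
    have uj: "(\<lambda>n. us (j n) t) \<longlonglongrightarrow> u t" if "t \<in> {0..T}" for t
      using LIMSEQ_subseq_LIMSEQ[OF lim_u sub] that by (simp add: o_def)
    have cont: "continuous_on {0..T} (us (j n))" for n
      by (rule continuous_on_subset[of "{0..real (j n) + 1}"]) (use tr[of "j n"] j[of n] in \<open>auto simp: trapped_def\<close>)
    have fixp: "clipped.volterra (As (j n)) (us (j n)) t = us (j n) t" if "t \<in> {0..T}" for n t
      using tr[of "j n"] j[of n] that by (auto simp: trapped_def)
    define M where "M = (max \<bar>slope_bound 1\<bar> \<bar>0\<bar> + \<bar>K\<bar> * (initial_value powr q * (T powr (\<beta> + 1) / (\<beta> + 1)))) powr (1 / P)"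
    interpret fam: causal_family T "slope_bound 1" 0 initial_value M clipped.volterra
      unfolding M_def by (rule clipped.causal_family_volterra[OF T])
    have "\<bar>u s - u t\<bar> \<le> M * \<bar>s - t\<bar>" if "s \<in> {0..T}" "t \<in> {0..T}" for s t
    proof (rule LIMSEQ_le_const2)
      show "(\<lambda>n. \<bar>us (j n) s - us (j n) t\<bar>) \<longlonglongrightarrow> \<bar>u s - u t\<bar>"
        by (intro tendsto_intros uj that)
      show "\<exists>N. \<forall>n\<ge>N. \<bar>us (j n) s - us (j n) t\<bar> \<le> M * \<bar>s - t\<bar>"
      proof (intro exI allI impI)
        fix n
        show "\<bar>us (j n) s - us (j n) t\<bar> \<le> M * \<bar>s - t\<bar>"
          using fam.lipschitz[OF As[of "j n"] cont[of n] that] unfolding fixp[OF that(1)] fixp[OF that(2)] .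
      qed
    qed
    then have u: "continuous_on {0..T} u" by (rule fam.continuous_on_lipschitz)
    have "clipped.volterra A u t = u t" if t: "t \<in> {0..T}" for t
    proof (rule LIMSEQ_unique)
      show "(\<lambda>n. clipped.volterra (As (j n)) (us (j n)) t) \<longlonglongrightarrow> clipped.volterra A u t"
        by (rule fam.cont[OF As Aj cont uj u t])
      show "(\<lambda>n. clipped.volterra (As (j n)) (us (j n)) t) \<longlonglongrightarrow> u t"
        using uj[OF t] unfolding fixp[OF t] .
    qed
    with u show ?thesis by blast
  qed
  have low: "barrier \<theta>_low t \<le> u t" and high: "u t \<le> barrier \<theta>_high t" if t: "0 < t" for t
  proof -
    have N: "t \<le> real n + 1" if "nat \<lceil>t\<rceil> \<le> n" for n using that by linarith
    show "barrier \<theta>_low t \<le> u t"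
      using N t by (intro LIMSEQ_le_const[OF lim_u]) (auto intro!: exI[of _ "nat \<lceil>t\<rceil>"] trapped_ge[OF tr])
    show "u t \<le> barrier \<theta>_high t"
      using N t by (intro LIMSEQ_le_const2[OF lim_u]) (auto intro!: exI[of _ "nat \<lceil>t\<rceil>"] trapped_le[OF tr])
  qed
  have u_pos: "0 < u t" and u_less: "u t < initial_value" if "0 < t" for t
    using low[OF that] high[OF that] barrier_pos[of \<theta>_low t] barrier_less[OF \<theta>_high(1) that]
    by (auto simp: initial_value_def)
  have flow: "flow P \<beta> K (\<lambda>x. x powr q) {0<..} u (clipped.momentum A u)"
    unfolding flow_def
  proof
    fix t :: real assume t: "t \<in> {0<..}"
    then have "flow P \<beta> K (truncated_power q initial_value) {0<..<t+1} u (clipped.momentum A u)"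
      using *[of "t + 1"] by (intro clipped.fixed_point_flow) auto
    moreover have "truncated_power q initial_value (u t) = u t powr q"
      using u_pos[of t] u_less[of t] t by (intro truncated_power_eq) auto
    ultimately show "(u has_real_derivative spow (1 / P) (clipped.momentum A u t)) (at t) \<and>
       (clipped.momentum A u has_real_derivative K * (t powr \<beta> * u t powr q)) (at t)"
      using t unfolding flow_def by (auto dest!: bspec[of _ _ t])
  qed
  have u01: "continuous_on {0..1} u" and fix01: "\<And>t. t \<in> {0..1} \<Longrightarrow> clipped.volterra A u t = u t"
    using *[of 1] by auto
  have "A \<noteq> 0"
  proof
    assume "A = 0"
    then have "initial_value \<le> u 1"
      using clipped.volterra_ge_start[OF _ truncated_power_nonneg u01, of 1] K fix01[of 1] by simp
    then show False using u_less[of 1] by simp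
  qed
  then have "A < 0" using A by auto
  moreover have "u 0 = initial_value" using fix01[of 0] by (simp add: clipped.volterra_def)
  moreover have "clipped.momentum A u 0 = A" by (simp add: clipped.momentum_def)
  ultimately show thesis
    using that u01 clipped.continuous_on_momentum[OF u01] flow low high by blast
qed

end

section \<open>Absence of solutions near the origin\<close>

text \<open>
Both halves of the argument compare with an explicit power that is unbounded at $0$: $r^{-m}$ for \<open>w\<close>, since
$(N-1)/(p-1) = m + 1 > 1$, and $r^{N+\<sigma>}$ for the momentum, since $N + \<sigma> < 0$.
\<close>

lemma no_solution_near_zero:
  fixes N p q \<sigma> r\<^sub>0 :: real
  assumes p: "1 < p" and q: "0 < q" and pN: "p < N" and N\<sigma>: "N < - \<sigma>" and r0: "0 < r\<^sub>0"
  shows "\<not> positive_solution N p q \<sigma> 1 {0<..<r\<^sub>0} w"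
proof
  assume sol: "positive_solution N p q \<sigma> 1 {0<..<r\<^sub>0} w"
  define m where "m = (N - p) / (p - 1)"
  have m: "0 < m" "(N - 1) / (p - 1) = m + 1" using p pN by (auto simp: m_def field_simps)
  define z where "z r = r powr (N - 1) * flux p w r" for r
  have w_pos: "0 < w r" if "r \<in> {0<..<r\<^sub>0}" for r
    using sol that by (auto simp: positive_solution_def)
  have dw: "(w has_real_derivative r powr (- m - 1) * spow (1 / (p - 1)) (z r)) (at r)"
    if r: "r \<in> {0<..<r\<^sub>0}" for r
  proof -
    have "flux p w r = r powr (1 - N) * z r"
      using r by (simp add: z_def powr_add[symmetric] mult.assoc[symmetric])
    then have "spow (1 / (p - 1)) (flux p w r) = r powr ((1 - N) * (1 / (p - 1))) * spow (1 / (p - 1)) (z r)"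
      using r by (simp add: spow_mult powr_powr)
    moreover have "spow (1 / (p - 1)) (flux p w r) = deriv w r"
      unfolding flux_def spow_eq_abs_powr using p by (simp add: spow_inverse)
    moreover have "(1 - N) * (1 / (p - 1)) = - ((N - 1) / (p - 1))" by (simp add: minus_divide_left)
    then have "(1 - N) * (1 / (p - 1)) = - m - 1" using m(2) by simp
    ultimately have "deriv w r = r powr (- m - 1) * spow (1 / (p - 1)) (z r)" by simp
    moreover have "(w has_real_derivative deriv w r) (at r)"
      using sol r by (auto simp: positive_solution_def DERIV_deriv_iff_real_differentiable)
    ultimately show ?thesis by simp
  qed
  have dz: "(z has_real_derivative - (r powr (N - 1 + \<sigma>) * w r powr q)) (at r)"
    if r: "r \<in> {0<..<r\<^sub>0}" for r
  proof -
    have "(flux p w has_real_derivative deriv (flux p w) r) (at r)"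
      using sol r by (auto simp: positive_solution_def DERIV_deriv_iff_real_differentiable)
    then have "(z has_real_derivative ((N - 1) * r powr (N - 1 - 1)) * flux p w r + deriv (flux p w) r * r powr (N - 1)) (at r)"
      unfolding z_def using r by (auto intro!: derivative_eq_intros)
    moreover have "r powr (N - 1 - 1) = r powr (N - 1) / r"
      using r by (subst powr_diff) auto
    moreover have "((N - 1) * (r powr (N - 1) / r)) * flux p w r + deriv (flux p w) r * r powr (N - 1) =
        r powr (N - 1) * (deriv (flux p w) r + (N - 1) / r * flux p w r)"
      using r by (simp add: field_simps)
    moreover have "deriv (flux p w) r + (N - 1) / r * flux p w r = - (r powr \<sigma> * w r powr q)"
      using sol r unfolding positive_solution_def by (auto dest!: bspec[of _ _ r])
    ultimately show ?thesis by (simp add: powr_add mult.assoc)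
  qed
  have z_anti: "z s \<le> z r" if "0 < r" "r \<le> s" "s < r\<^sub>0" for r s
  proof (rule DERIV_nonpos_imp_nonincreasing[OF that(2)])
    fix x assume "r \<le> x" "x \<le> s"
    then show "\<exists>y. (z has_real_derivative y) (at x) \<and> y \<le> 0"
      using dz[of x] that by (intro exI conjI) auto
  qed
  have blow_up: "\<exists>r>0. r < r1 \<and> X < k * r powr e" if "0 < r1" "0 < k" "e < 0" for r1 k e X :: real
  proof -
    have "filterlim (\<lambda>r. k * r powr e) at_top (at_right 0)" using that by real_asymp
    then have "eventually (\<lambda>r. X < k * r powr e) (at_right 0)" by (simp add: filterlim_at_top_dense)
    with eventually_at_right_less[of 0]
    have "eventually (\<lambda>r. 0 < r \<and> r < r1 \<and> X < k * r powr e) (at_right 0)"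
      using eventually_at_right_real[OF that(1)] by eventually_elim auto
    then show ?thesis using eventually_happens'[OF trivial_limit_at_right_real] by blast
  qed
  have z_nonpos: "z r1 \<le> 0" if r1: "r1 \<in> {0<..<r\<^sub>0}" for r1
  proof (rule ccontr)
    assume "\<not> z r1 \<le> 0"
    define k where "k = spow (1 / (p - 1)) (z r1)"
    have k: "0 < k" using \<open>\<not> z r1 \<le> 0\<close> by (simp add: k_def spow_pos)
    obtain r where r: "0 < r" "r < r1" "w r1 + k / m * r1 powr (- m) < k / m * r powr (- m)"
      using blow_up[of r1 "k / m" "- m"] r1 k m by auto
    have "w r + k / m * r powr (- m) \<le> w r1 + k / m * r1 powr (- m)"
    proof (rule DERIV_nonneg_imp_nondecreasing[where f = "\<lambda>r. w r + k / m * r powr (- m)"])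
      fix x assume x: "r \<le> x" "x \<le> r1"
      then have xI: "x \<in> {0<..<r\<^sub>0}" using r r1 by auto
      have "((\<lambda>r. w r + k / m * r powr (- m)) has_real_derivative
          x powr (- m - 1) * spow (1 / (p - 1)) (z x) + k / m * (- m * x powr (- m - 1))) (at x)"
        using xI m(1) by (auto intro!: derivative_eq_intros dw)
      moreover have "k \<le> spow (1 / (p - 1)) (z x)"
        unfolding k_def using z_anti[of x r1] x r r1 p by (intro spow_mono) auto
      then have "x powr (- m - 1) * k \<le> x powr (- m - 1) * spow (1 / (p - 1)) (z x)"
        by (intro mult_left_mono) auto
      then have "0 \<le> x powr (- m - 1) * spow (1 / (p - 1)) (z x) + k / m * (- m * x powr (- m - 1))"
        using m by (simp add: mult.commute)
      ultimately show "\<exists>y. ((\<lambda>r. w r + k / m * r powr (- m)) has_real_derivative y) (at x) \<and> 0 \<le> y"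
        by blast
    qed (use r in auto)
    with r w_pos[of r] r1 show False by auto
  qed
  define r1 where "r1 = r\<^sub>0 / 2"
  have r1: "r1 \<in> {0<..<r\<^sub>0}" using r0 by (simp add: r1_def)
  have w_ge: "w r1 \<le> w r" if "0 < r" "r \<le> r1" for r
  proof (rule DERIV_nonpos_imp_nonincreasing[OF that(2)])
    fix x assume "r \<le> x" "x \<le> r1"
    then have x: "x \<in> {0<..<r\<^sub>0}" using that r1 by auto
    have "spow (1 / (p - 1)) (z x) \<le> 0"
      using spow_mono[OF _ z_nonpos[OF x], of "1 / (p - 1)"] p by simp
    then show "\<exists>y. (w has_real_derivative y) (at x) \<and> y \<le> 0"
      using dw[OF x] by (intro exI[of _ "x powr (- m - 1) * spow (1 / (p - 1)) (z x)"]) (auto intro: mult_nonneg_nonpos)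
  qed
  define e where "e = N + \<sigma>"
  define k where "k = w r1 powr q / (- e)"
  have e: "e < 0" using N\<sigma> by (simp add: e_def)
  have k: "0 < k" using w_pos[OF r1] e by (auto simp: k_def divide_pos_neg)
  obtain r where r: "0 < r" "r < r1" "k * r1 powr e - z r1 < k * r powr e"
    using blow_up[of r1 k e] r1 k e by auto
  have "z r1 - k * r1 powr e \<le> z r - k * r powr e"
  proof (rule DERIV_nonpos_imp_nonincreasing[where f = "\<lambda>r. z r - k * r powr e"])
    fix x assume x: "r \<le> x" "x \<le> r1"
    then have xI: "x \<in> {0<..<r\<^sub>0}" using r r1 by auto
    have "((\<lambda>r. z r - k * r powr e) has_real_derivative
        - (x powr (N - 1 + \<sigma>) * w x powr q) - k * (e * x powr (e - 1))) (at x)"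
      using xI by (auto intro!: derivative_eq_intros dz)
    moreover have "w r1 powr q \<le> w x powr q"
      using w_ge[of x] x r w_pos[OF r1] q by (intro powr_mono2) auto
    then have "x powr (e - 1) * w r1 powr q \<le> x powr (e - 1) * w x powr q"
      by (intro mult_left_mono) auto
    then have "- (x powr (N - 1 + \<sigma>) * w x powr q) - k * (e * x powr (e - 1)) \<le> 0"
    proof -
      have "k * (e * x powr (e - 1)) = - (x powr (e - 1) * w r1 powr q)" using e by (simp add: k_def)
      moreover have e1: "N - 1 + \<sigma> = e - 1" by (simp add: e_def)
      ultimately show ?thesis unfolding e1 using \<open>x powr (e - 1) * w r1 powr q \<le> x powr (e - 1) * w x powr q\<close> by simp
    qed
    ultimately show "\<exists>y. ((\<lambda>r. z r - k * r powr e) has_real_derivative y) (at x) \<and> y \<le> 0"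
      by blast
  qed (use r in auto)
  with r z_nonpos[of r] r1 show False by auto
qed

section \<open>The substitution that moves infinity to zero\<close>

locale exponents =
  fixes N p q \<sigma> :: real
  assumes p: "1 < p" and q: "p - 1 < q" and pN: "p < N" and N\<sigma>: "N < - \<sigma>"
begin

definition m :: real where "m = (N - p) / (p - 1)"

definition \<beta> :: real where "\<beta> = - (N + \<sigma>) / m - 1"

lemma m_pos: "0 < m" and m_plus_1: "(N - 1) / (p - 1) = m + 1"
  using p pN by (auto simp: m_def field_simps)

lemma m_plus_1': "(m + 1) * (p - 1) = N - 1"
  using p by (simp add: m_def field_simps)

lemma \<beta>: "- 1 < \<beta>" and m_\<beta>: "m * \<beta> = - (N + \<sigma>) - m"
  using m_pos N\<sigma> by (auto simp: \<beta>_def field_simps)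

lemma q_pos: "0 < q"
  using p q by simp

lemma has_derivative_pullback:
  assumes flow: "flow (p - 1) \<beta> \<kappa> (\<lambda>x. x powr q) I u z"
    and r: "0 < r" "r powr (- m) \<in> I"
  shows "((\<lambda>r. u (r powr (- m))) has_real_derivative
    - (m * r powr (- m - 1) * spow (1 / (p - 1)) (z (r powr (- m))))) (at r)"
proof -
  have "((\<lambda>r. u (r powr (- m))) has_real_derivative
    spow (1 / (p - 1)) (z (r powr (- m))) * (- m * r powr (- m - 1))) (at r)"
    using flow r by (intro DERIV_chain2[of u]) (auto simp: flow_def intro!: derivative_eq_intros)
  then show ?thesis by (simp add: mult_ac)
qed

text \<open>
The exponent \<open>m\<close> is the one for which $r^{N-1}|w'|^{p-2}w' = -m^{p-1} z(r^{-m})$, so that the first order term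
of the radial operator disappears. The outer derivative contributes one more factor $m$, whence the constant
$m^{-p}$ in front of the nonlinearity.
\<close>

context
  fixes \<epsilon> :: real and I J :: "real set" and u z :: "real \<Rightarrow> real"
  assumes flow: "flow (p - 1) \<beta> (- \<epsilon> * m powr (- p)) (\<lambda>x. x powr q) I u z"
    and u_pos: "\<And>t. t \<in> I \<Longrightarrow> 0 < u t"
    and J: "open J" "\<And>r. r \<in> J \<Longrightarrow> 0 < r" "\<And>r. r \<in> J \<Longrightarrow> r powr (- m) \<in> I"
begin

lemma flux_pullback:
  assumes r: "r \<in> J"
  shows "flux p (\<lambda>r. u (r powr (- m))) r = - (m powr (p - 1) * r powr (1 - N) * z (r powr (- m)))"
proof -
  have r0: "0 < r" using J r by auto
  have "flux p (\<lambda>r. u (r powr (- m))) r =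
      spow (p - 1) (- (m * r powr (- m - 1) * spow (1 / (p - 1)) (z (r powr (- m)))))"
    unfolding flux_def spow_eq_abs_powr DERIV_imp_deriv[OF has_derivative_pullback[OF flow J(2,3)[OF r]]] ..
  also have "\<dots> = - ((m * r powr (- m - 1)) powr (p - 1) * z (r powr (- m)))"
    using r0 m_pos p spow_inverse[of "1 / (p - 1)"] by (simp add: spow_minus spow_mult)
  also have "(m * r powr (- m - 1)) powr (p - 1) = m powr (p - 1) * r powr (- ((m + 1) * (p - 1)))"
    using r0 m_pos by (simp add: powr_mult powr_powr algebra_simps)
  finally show ?thesis by (simp add: m_plus_1')
qed

lemma positive_solution_pullback: "positive_solution N p q \<sigma> \<epsilon> J (\<lambda>r. u (r powr (- m)))"
  unfolding positive_solution_def
proof (intro ballI conjI)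
  fix r assume r: "r \<in> J"
  then have r0: "0 < r" and tI: "r powr (- m) \<in> I" using J by auto
  let ?w = "\<lambda>r. u (r powr (- m))" and ?t = "r powr (- m)"
  show "0 < ?w r" using u_pos tI by auto
  show "?w differentiable (at r)"
    using has_derivative_pullback[OF flow r0 tI] real_differentiable_def by blast
  let ?d = "- (m powr (p - 1) * ((1 - N) * r powr (1 - N - 1) * z ?t +
      - \<epsilon> * m powr (- p) * (?t powr \<beta> * u ?t powr q) * (- m * r powr (- m - 1)) * r powr (1 - N)))"
  have dz: "((\<lambda>r. z (r powr (- m))) has_real_derivative
      - \<epsilon> * m powr (- p) * (?t powr \<beta> * u ?t powr q) * (- m * r powr (- m - 1))) (at r)"
  proof (rule DERIV_chain2[where f = z])
    show "(z has_real_derivative - \<epsilon> * m powr (- p) * (?t powr \<beta> * u ?t powr q)) (at ?t)"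
      using flow tI by (simp add: flow_def)
  qed (use r0 in \<open>auto intro!: derivative_eq_intros\<close>)
  have "((\<lambda>r. - (m powr (p - 1) * r powr (1 - N) * z (r powr (- m)))) has_real_derivative ?d) (at r)"
    using r0 by (auto intro!: derivative_eq_intros dz simp: algebra_simps)
  then have df: "(flux p ?w has_real_derivative ?d) (at r)"
    by (rule has_field_derivative_transform_within_open[OF _ J(1) r]) (simp add: flux_pullback)
  then show "flux p ?w differentiable (at r)" using real_differentiable_def by blast
  have 1: "r powr (1 - N - 1) = r powr (1 - N) / r" using r0 by (subst powr_diff) auto
  have 2: "m powr (p - 1) * m powr (- p) * m = 1"
  proof -
    have "m powr (p - 1) * m powr (- p) * m powr 1 = m powr ((p - 1) + - p + 1)"
      by (simp only: powr_add)
    then show ?thesis using m_pos by simp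
  qed
  have "?t powr \<beta> * r powr (- m - 1) * r powr (1 - N) = r powr (- (m * \<beta>) + (- m - 1) + (1 - N))"
    by (simp only: powr_powr powr_add) simp
  also have "- (m * \<beta>) + (- m - 1) + (1 - N) = \<sigma>" using m_\<beta> by simp
  finally have 3: "?t powr \<beta> * r powr (- m - 1) * r powr (1 - N) = r powr \<sigma>" .
  have "- ?d - (N - 1) / r * (- (m powr (p - 1) * r powr (1 - N) * z ?t)) =
     \<epsilon> * (m powr (p - 1) * m powr (- p) * m) * (?t powr \<beta> * r powr (- m - 1) * r powr (1 - N)) * u ?t powr q"
  proof -
    have "- (- (X * ((1 - N) * (R / r) * Z + - \<epsilon> * M * (Y * W) * (- m * V) * R)))
        - (N - 1) / r * (- (X * R * Z)) = \<epsilon> * (X * M * m) * (Y * V * R) * W"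
      for X R Z M Y W V :: real
      using r0 by (simp add: field_simps)
    then show ?thesis unfolding 1 .
  qed
  then show "- deriv (flux p ?w) r - (N - 1) / r * flux p ?w r = \<epsilon> * r powr \<sigma> * ?w r powr q"
    unfolding DERIV_imp_deriv[OF df] flux_pullback[OF r] 2 3 by simp
qed

end

end

lemma (in emden_fowler) power_profile_flow:
  "flow P \<beta> K (\<lambda>x. x powr q) {0<..} (\<lambda>t. a * t powr (- \<mu>))
    (\<lambda>t. - ((a * \<mu>) powr P * t powr (- ((\<mu> + 1) * P))))"
  unfolding flow_def
proof (intro ballI conjI)
  fix t :: real assume "t \<in> {0<..}"
  then have t: "0 < t" by simp
  have "spow (1 / P) (- ((a * \<mu>) powr P * t powr (- ((\<mu> + 1) * P)))) = - (a * \<mu> * t powr (- (\<mu> + 1)))"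
    using P a \<mu> t by (simp add: spow_minus spow_pos powr_mult powr_powr)
  moreover have "((\<lambda>t. a * t powr (- \<mu>)) has_real_derivative - (a * \<mu> * t powr (- (\<mu> + 1)))) (at t)"
    using t by (auto intro!: derivative_eq_intros)
  ultimately show "((\<lambda>t. a * t powr (- \<mu>)) has_real_derivative
      spow (1 / P) (- ((a * \<mu>) powr P * t powr (- ((\<mu> + 1) * P))))) (at t)" by simp
  have dz: "((\<lambda>t. - ((a * \<mu>) powr P * t powr (- ((\<mu> + 1) * P)))) has_real_derivative
      (a * \<mu>) powr P * ((\<mu> + 1) * P * t powr (- ((\<mu> + 1) * P) - 1))) (at t)"
    using t by (auto intro!: derivative_eq_intros)
  have eq: "K * (t powr \<beta> * (a * t powr (- \<mu>)) powr q) =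
      (K * a powr (q - P)) * a powr P * (t powr \<beta> * t powr (- \<mu> * q))"
  proof -
    have "a powr q = a powr (q - P) * a powr P" using a by (simp add: powr_add[symmetric])
    then show ?thesis using a by (simp add: powr_mult powr_powr mult_ac)
  qed
  have "\<beta> + - \<mu> * q = - ((\<mu> + 1) * P) - 1" using scaling by (simp add: algebra_simps)
  then have exp: "t powr \<beta> * t powr (- \<mu> * q) = t powr (- ((\<mu> + 1) * P) - 1)"
    by (simp only: powr_add[symmetric])
  show "((\<lambda>t. - ((a * \<mu>) powr P * t powr (- ((\<mu> + 1) * P)))) has_real_derivative
      K * (t powr \<beta> * (a * t powr (- \<mu>)) powr q)) (at t)"
  proof -
    have "(a * \<mu>) powr P * ((\<mu> + 1) * P * t powr (- ((\<mu> + 1) * P) - 1)) =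
        K * a powr (q - P) * a powr P * t powr (- ((\<mu> + 1) * P) - 1)"
      unfolding amplitude using a \<mu> by (simp add: powr_mult mult_ac)
    with dz eq exp show ?thesis by (simp only:)
  qed
qed

context exponents
begin

lemma at_top_to_at_right: "filterlim (\<lambda>r. r powr (- m)) (at_right 0) at_top"
  using m_pos by real_asymp

lemma at_right_to_at_top: "filterlim (\<lambda>r. r powr (- m)) at_top (at_right 0)"
  using m_pos by real_asymp

lemma scaled_derivative_pullback:
  assumes flow: "flow (p - 1) \<beta> \<kappa> (\<lambda>x. x powr q) I u z"
    and r: "0 < r" "r powr (- m) \<in> I"
  shows "r powr (m + 1) * deriv (\<lambda>r. u (r powr (- m))) r = - (m * spow (1 / (p - 1)) (z (r powr (- m))))"
proof -
  from DERIV_imp_deriv[OF has_derivative_pullback[OF flow r]]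
  have "r powr (m + 1) * deriv (\<lambda>r. u (r powr (- m))) r =
      - (m * spow (1 / (p - 1)) (z (r powr (- m))) * (r powr (m + 1) * r powr (- m - 1)))"
    by (simp add: mult_ac)
  also have "r powr (m + 1) * r powr (- m - 1) = 1" using r by (simp add: powr_add[symmetric])
  finally show ?thesis by simp
qed

lemma pullback_tendsto:
  assumes flow: "flow (p - 1) \<beta> (- \<epsilon> * m powr (- p)) (\<lambda>x. x powr q) {0<..<\<tau>} u z"
    and \<tau>: "0 < \<tau>" and u: "continuous_on {0..\<tau>} u" and z: "continuous_on {0..\<tau>} z"
  shows "((\<lambda>r. u (r powr (- m))) \<longlongrightarrow> u 0) at_top"
    and "((\<lambda>r. r powr ((N - 1) / (p - 1)) * deriv (\<lambda>r. u (r powr (- m))) r) \<longlongrightarrow>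
      - (m * spow (1 / (p - 1)) (z 0))) at_top"
proof -
  have lim: "((\<lambda>r. g (r powr (- m))) \<longlongrightarrow> g 0) at_top" if "continuous_on {0..\<tau>} g" for g :: "real \<Rightarrow> real"
    using that \<tau> by (intro filterlim_compose[OF _ at_top_to_at_right]) (simp add: continuous_on_Icc_at_rightD)
  show "((\<lambda>r. u (r powr (- m))) \<longlongrightarrow> u 0) at_top" by (rule lim[OF u])
  have "((\<lambda>r. - (m * spow (1 / (p - 1)) (z (r powr (- m))))) \<longlongrightarrow> - (m * spow (1 / (p - 1)) (z 0))) at_top"
    using p by (intro tendsto_intros tendsto_spow lim z) auto
  moreover have "\<forall>\<^sub>F r in at_top. - (m * spow (1 / (p - 1)) (z (r powr (- m)))) =
      r powr ((N - 1) / (p - 1)) * deriv (\<lambda>r. u (r powr (- m))) r"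
    using eventually_gt_at_top[of 0] eventually_compose_filterlim[OF eventually_at_right_real[OF \<tau>] at_top_to_at_right]
    by eventually_elim (simp add: m_plus_1 scaled_derivative_pullback[OF flow])
  ultimately show "((\<lambda>r. r powr ((N - 1) / (p - 1)) * deriv (\<lambda>r. u (r powr (- m))) r) \<longlongrightarrow>
      - (m * spow (1 / (p - 1)) (z 0))) at_top"
    by (rule Lim_transform_eventually)
qed

text \<open>
Truncating the power above \<open>C + 1\<close> does not matter near $t = 0$. Positivity for small \<open>t\<close> comes from the initial
value or, if that vanishes, from the initial slope.
\<close>

lemma local_profile:
  assumes C: "0 \<le> C" and CA: "0 < C \<or> 0 < A"
  obtains \<tau> u z where "0 < \<tau>" "continuous_on {0..\<tau>} u" "continuous_on {0..\<tau>} z" "u 0 = C" "z 0 = A"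
    "flow (p - 1) \<beta> \<kappa> (\<lambda>x. x powr q) {0<..<\<tau>} u z" "\<And>t. t \<in> {0<..<\<tau>} \<Longrightarrow> 0 < u t"
proof -
  interpret volterra "p - 1" \<beta> \<kappa> "(C + 1) powr q" C "truncated_power q (C + 1)"
    using volterra_truncated_power[of "p - 1" \<beta> q "C + 1"] p \<beta> q_pos C by simp
  obtain u z where u: "continuous_on {0..1} u" "u 0 = C" and z: "continuous_on {0..1} z" "z 0 = A"
    and flow: "flow (p - 1) \<beta> \<kappa> (truncated_power q (C + 1)) {0<..<1} u z"
    by (rule initial_value_problem[of 1 A]) auto
  have u_lim: "(u \<longlongrightarrow> C) (at_right 0)" and z_lim: "(z \<longlongrightarrow> A) (at_right 0)"
    using continuous_on_Icc_at_rightD[OF u(1)] continuous_on_Icc_at_rightD[OF z(1)] u(2) z(2) by auto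
  have "\<forall>\<^sub>F t in at_right 0. 0 < u t"
  proof (cases "0 < C")
    case True
    then show ?thesis using order_tendstoD(1)[OF u_lim] by blast
  next
    case False
    then have "C = 0" "0 < A" using C CA by auto
    obtain b where b: "0 < b" "\<And>t. 0 < t \<Longrightarrow> t < b \<Longrightarrow> 0 < z t"
      using order_tendstoD(1)[OF z_lim \<open>0 < A\<close>] by (auto simp: eventually_at_right[of 0 1])
    have "0 < u t" if t: "0 < t" "t < min b 1" for t
    proof -
      have "u 0 < u t"
      proof (rule DERIV_pos_imp_increasing_open[OF t(1)])
        fix s assume s: "0 < s" "s < t"
        then have "0 < z s" using b t by auto
        then have "0 < spow (1 / (p - 1)) (z s)" by (simp add: spow_pos)
        moreover have "(u has_real_derivative spow (1 / (p - 1)) (z s)) (at s)"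
          using flow s t by (auto simp: flow_def)
        ultimately show "\<exists>y. (u has_real_derivative y) (at s) \<and> 0 < y" by blast
      qed (use t in \<open>auto intro: continuous_on_subset[OF u(1)]\<close>)
      then show ?thesis using u(2) \<open>C = 0\<close> by simp
    qed
    then show ?thesis
      unfolding eventually_at_right[OF zero_less_one] using b(1) by (intro exI[of _ "min b 1"]) auto
  qed
  moreover have "\<forall>\<^sub>F t in at_right 0. u t < C + 1"
    using order_tendstoD(2)[OF u_lim] by simp
  moreover have "\<forall>\<^sub>F t in at_right 0. t \<in> {0<..<(1::real)}"
    by (rule eventually_at_right_real) simp
  ultimately have "\<forall>\<^sub>F t in at_right 0. 0 < u t \<and> u t < C + 1 \<and> t < 1"
    by eventually_elim auto
  then obtain \<tau> where \<tau>: "0 < \<tau>" "\<And>t. 0 < t \<Longrightarrow> t < \<tau> \<Longrightarrow> 0 < u t \<and> u t < C + 1 \<and> t < 1"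
    by (auto simp: eventually_at_right[of 0 1])
  have "\<tau> \<le> 1" using \<tau>(2)[of 1] by (intro leI notI) simp
  show thesis
  proof (rule that[of \<tau> u z])
    show "0 < \<tau>" "u 0 = C" "z 0 = A" by fact+
    show "continuous_on {0..\<tau>} u" "continuous_on {0..\<tau>} z"
      using \<open>\<tau> \<le> 1\<close> by (auto intro: continuous_on_subset[OF u(1)] continuous_on_subset[OF z(1)])
    show "0 < u t" if "t \<in> {0<..<\<tau>}" for t using \<tau>(2) that by auto
    show "flow (p - 1) \<beta> \<kappa> (\<lambda>x. x powr q) {0<..<\<tau>} u z"
      unfolding flow_def
    proof
      fix t assume t: "t \<in> {0<..<\<tau>}"
      then have "truncated_power q (C + 1) (u t) = u t powr q"
        using \<tau>(2)[of t] by (intro truncated_power_eq) auto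
      then show "(u has_real_derivative spow (1 / (p - 1)) (z t)) (at t) \<and>
          (z has_real_derivative \<kappa> * (t powr \<beta> * u t powr q)) (at t)"
        using flow t \<tau>(2)[of t] unfolding flow_def by (auto dest!: bspec[of _ _ t])
    qed
  qed
qed

lemma local_solution_pullback:
  assumes flow: "flow (p - 1) \<beta> (- \<epsilon> * m powr (- p)) (\<lambda>x. x powr q) {0<..<\<tau>} u z"
    and \<tau>: "0 < \<tau>" and u_pos: "\<And>t. t \<in> {0<..<\<tau>} \<Longrightarrow> 0 < u t"
    and Q: "Q (\<lambda>r. u (r powr (- m)))"
  shows "\<exists>r\<^sub>0 w. local_solution_at_infinity N p q \<sigma> \<epsilon> r\<^sub>0 w \<and> Q w"
proof -
  from eventually_compose_filterlim[OF eventually_at_right_real[OF \<tau>] at_top_to_at_right]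
  obtain b where b: "\<And>r. b \<le> r \<Longrightarrow> r powr (- m) \<in> {0<..<\<tau>}"
    unfolding eventually_at_top_linorder by blast
  have "positive_solution N p q \<sigma> \<epsilon> {max 1 b<..} (\<lambda>r. u (r powr (- m)))"
    by (rule positive_solution_pullback[OF flow u_pos]) (use b in auto)
  then have "local_solution_at_infinity N p q \<sigma> \<epsilon> (max 1 b) (\<lambda>r. u (r powr (- m)))"
    by (simp add: local_solution_at_infinity_def)
  with Q show ?thesis by (intro exI[of _ "max 1 b"] exI[of _ "\<lambda>r. u (r powr (- m))"] conjI)
qed

section \<open>The three behaviours at infinity\<close>

text \<open>
The case of zero initial slope. L'Hospital's rule gives $z(t) \<sim> -\<epsilon>\, m^{-p} C^q t^{\<beta>+1}/(\<beta>+1)$ as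
$t \<rightarrow> 0$, and the power of \<open>r\<close> that normalises \<open>w'\<close> is the one that turns $z(t)$ into
$z(t)/t^{\<beta>+1}$.
\<close>

lemma exists_behaviour1:
  assumes C: "0 < C" and \<epsilon>: "\<epsilon> \<in> {1, -1}"
  shows "\<exists>r\<^sub>0 w. local_solution_at_infinity N p q \<sigma> \<epsilon> r\<^sub>0 w \<and>
    behaviour1 p \<sigma> \<epsilon> C (m * (m powr (- p) * C powr q / (\<beta> + 1)) powr (1 / (p - 1))) w"
proof -
  obtain \<tau> u z where \<tau>: "0 < \<tau>" and u: "continuous_on {0..\<tau>} u" "u 0 = C"
    and z: "continuous_on {0..\<tau>} z" "z 0 = 0"
    and flow: "flow (p - 1) \<beta> (- \<epsilon> * m powr (- p)) (\<lambda>x. x powr q) {0<..<\<tau>} u z"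
    and u_pos: "\<And>t. t \<in> {0<..<\<tau>} \<Longrightarrow> 0 < u t"
    by (rule local_profile[of C 0 "- \<epsilon> * m powr (- p)"]) (use C in auto)
  define G where "G = m powr (- p) * C powr q / (\<beta> + 1)"
  let ?w = "\<lambda>r. u (r powr (- m))"
  have G: "0 < G" using m_pos C \<beta> by (simp add: G_def)
  have near: "\<forall>\<^sub>F t in at_right 0. t \<in> {0<..<\<tau>}" by (rule eventually_at_right_real[OF \<tau>])
  have "((\<lambda>t. z t / t powr (\<beta> + 1)) \<longlongrightarrow> - \<epsilon> * m powr (- p) * C powr q / (\<beta> + 1)) (at_right 0)"
  proof (rule lhopital_right_0)
    show "(z \<longlongrightarrow> 0) (at_right 0)" using continuous_on_Icc_at_rightD[OF z(1) \<tau>] z(2) by simp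
    show "((\<lambda>t. t powr (\<beta> + 1)) \<longlongrightarrow> 0) (at_right 0)" using \<beta> by real_asymp
    show "\<forall>\<^sub>F t in at_right 0. t powr (\<beta> + 1) \<noteq> 0" using near by eventually_elim auto
    show "\<forall>\<^sub>F t in at_right 0. (\<beta> + 1) * t powr \<beta> \<noteq> 0" using near by eventually_elim (use \<beta> in auto)
    show "\<forall>\<^sub>F t in at_right 0. (z has_real_derivative - \<epsilon> * m powr (- p) * (t powr \<beta> * u t powr q)) (at t)"
      using near by eventually_elim (use flow in \<open>auto simp: flow_def\<close>)
    show "\<forall>\<^sub>F t in at_right 0. ((\<lambda>t. t powr (\<beta> + 1)) has_real_derivative (\<beta> + 1) * t powr \<beta>) (at t)"
      using near by eventually_elim (auto intro!: derivative_eq_intros)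
    have "((\<lambda>t. - \<epsilon> * m powr (- p) * u t powr q / (\<beta> + 1)) \<longlongrightarrow> - \<epsilon> * m powr (- p) * C powr q / (\<beta> + 1)) (at_right 0)"
      using continuous_on_Icc_at_rightD[OF u(1) \<tau>] u(2) C \<beta> by (intro tendsto_intros) auto
    moreover have "\<forall>\<^sub>F t in at_right 0. - \<epsilon> * m powr (- p) * u t powr q / (\<beta> + 1) =
        - \<epsilon> * m powr (- p) * (t powr \<beta> * u t powr q) / ((\<beta> + 1) * t powr \<beta>)"
      using near by eventually_elim auto
    ultimately show "((\<lambda>t. - \<epsilon> * m powr (- p) * (t powr \<beta> * u t powr q) / ((\<beta> + 1) * t powr \<beta>)) \<longlongrightarrow>
        - \<epsilon> * m powr (- p) * C powr q / (\<beta> + 1)) (at_right 0)"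
      by (rule Lim_transform_eventually)
  qed
  then have "((\<lambda>t. - (m * spow (1 / (p - 1)) (z t / t powr (\<beta> + 1)))) \<longlongrightarrow>
      - (m * spow (1 / (p - 1)) (- \<epsilon> * m powr (- p) * C powr q / (\<beta> + 1)))) (at_right 0)"
    using p by (intro tendsto_minus tendsto_mult_left tendsto_spow) auto
  also have "- (m * spow (1 / (p - 1)) (- \<epsilon> * m powr (- p) * C powr q / (\<beta> + 1))) = \<epsilon> * (m * G powr (1 / (p - 1)))"
  proof -
    have "- \<epsilon> * m powr (- p) * C powr q / (\<beta> + 1) = - (\<epsilon> * G)" by (simp add: G_def)
    then show ?thesis using \<epsilon> G by (auto simp: spow_minus spow_pos)
  qed
  finally have lim: "((\<lambda>t. - (m * spow (1 / (p - 1)) (z t / t powr (\<beta> + 1)))) \<longlongrightarrow> \<epsilon> * (m * G powr (1 / (p - 1)))) (at_right 0)" .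
  have "((\<lambda>r. - (m * spow (1 / (p - 1)) (z (r powr (- m)) / (r powr (- m)) powr (\<beta> + 1)))) \<longlongrightarrow> \<epsilon> * (m * G powr (1 / (p - 1)))) at_top"
    by (rule filterlim_compose[OF lim at_top_to_at_right])
  moreover have "\<forall>\<^sub>F r in at_top. - (m * spow (1 / (p - 1)) (z (r powr (- m)) / (r powr (- m)) powr (\<beta> + 1))) =
      r powr (- ((\<sigma> + 1) / (p - 1))) * deriv ?w r"
    using eventually_gt_at_top[of 0] eventually_compose_filterlim[OF near at_top_to_at_right]
  proof eventually_elim
    case (elim r)
    have "spow (1 / (p - 1)) (z (r powr (- m)) / (r powr (- m)) powr (\<beta> + 1)) =
        spow (1 / (p - 1)) (r powr (- (N + \<sigma>)) * z (r powr (- m)))"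
    proof -
      have "- m * (\<beta> + 1) = N + \<sigma>" using m_\<beta> by (simp add: algebra_simps)
      then have "(r powr (- m)) powr (\<beta> + 1) = r powr (N + \<sigma>)" by (simp only: powr_powr)
      then show ?thesis by (simp only: powr_minus_divide) simp
    qed
    also have "\<dots> = r powr (- (N + \<sigma>) / (p - 1)) * spow (1 / (p - 1)) (z (r powr (- m)))"
      using elim by (simp add: spow_mult powr_powr)
    finally have "- (m * spow (1 / (p - 1)) (z (r powr (- m)) / (r powr (- m)) powr (\<beta> + 1))) =
        r powr (- (N + \<sigma>) / (p - 1)) * (r powr (m + 1) * deriv ?w r)"
      using scaled_derivative_pullback[OF flow elim] by simp
    also have "\<dots> = r powr (- (N + \<sigma>) / (p - 1) + (m + 1)) * deriv ?w r"
      by (simp only: powr_add mult.assoc)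
    also have "- (N + \<sigma>) / (p - 1) + (m + 1) = - ((\<sigma> + 1) / (p - 1))"
      unfolding m_plus_1[symmetric] by (simp add: add_divide_distrib[symmetric] minus_divide_left)
    finally show ?case .
  qed
  ultimately have "((\<lambda>r. r powr (- ((\<sigma> + 1) / (p - 1))) * deriv ?w r) \<longlongrightarrow> \<epsilon> * (m * G powr (1 / (p - 1)))) at_top"
    by (rule Lim_transform_eventually)
  then have B: "behaviour1 p \<sigma> \<epsilon> C (m * G powr (1 / (p - 1))) ?w"
    using pullback_tendsto(1)[OF flow \<tau> u(1) z(1)] u(2) by (simp add: behaviour1_def)
  show ?thesis unfolding G_def[symmetric]
    by (rule local_solution_pullback[where Q = "behaviour1 p \<sigma> \<epsilon> C (m * G powr (1 / (p - 1)))", OF flow \<tau> _ B]) (rule u_pos)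
qed

text \<open>
The case $u(0) = 0$, $u'(0) = k$: here $r^m w = u(t)/t$ is a difference quotient at $0$.
\<close>

lemma exists_behaviour2:
  assumes k: "0 < k"
  shows "\<exists>r\<^sub>0 w. local_solution_at_infinity N p q \<sigma> \<epsilon> r\<^sub>0 w \<and> behaviour2 N p k (m * k) w"
proof -
  have A: "spow (1 / (p - 1)) (k powr (p - 1)) = k"
    using spow_inverse[of "p - 1" k] p unfolding spow_pos[OF k] by simp
  obtain \<tau> u z where \<tau>: "0 < \<tau>" and u: "continuous_on {0..\<tau>} u" "u 0 = 0"
    and z: "continuous_on {0..\<tau>} z" "z 0 = k powr (p - 1)"
    and flow: "flow (p - 1) \<beta> (- \<epsilon> * m powr (- p)) (\<lambda>x. x powr q) {0<..<\<tau>} u z"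
    and u_pos: "\<And>t. t \<in> {0<..<\<tau>} \<Longrightarrow> 0 < u t"
    by (rule local_profile[of 0 "k powr (p - 1)" "- \<epsilon> * m powr (- p)"]) (use k in auto)
  let ?w = "\<lambda>r. u (r powr (- m))"
  have near: "\<forall>\<^sub>F t in at_right 0. t \<in> {0<..<\<tau>}" by (rule eventually_at_right_real[OF \<tau>])
  have lim: "((\<lambda>t. u t / t) \<longlongrightarrow> k) (at_right 0)"
  proof (rule lhopital_right_0)
    show "(u \<longlongrightarrow> 0) (at_right 0)" using continuous_on_Icc_at_rightD[OF u(1) \<tau>] u(2) by simp
    show "\<forall>\<^sub>F t in at_right 0. (u has_real_derivative spow (1 / (p - 1)) (z t)) (at t)"
      using near by eventually_elim (use flow in \<open>auto simp: flow_def\<close>)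
    show "\<forall>\<^sub>F t in at_right 0. ((\<lambda>t. t) has_real_derivative 1) (at t)" by simp
    show "\<forall>\<^sub>F t in at_right 0. t \<noteq> (0::real)" using near by eventually_elim auto
    show "((\<lambda>t. spow (1 / (p - 1)) (z t) / 1) \<longlongrightarrow> k) (at_right 0)"
      using tendsto_spow[OF _ continuous_on_Icc_at_rightD[OF z(1) \<tau>], of "1 / (p - 1)"] p z(2) A by simp
  qed auto
  have "((\<lambda>r. ?w r / r powr (- m)) \<longlongrightarrow> k) at_top"
    by (rule filterlim_compose[OF lim at_top_to_at_right])
  then have "((\<lambda>r. r powr ((N - p) / (p - 1)) * ?w r) \<longlongrightarrow> k) at_top"
    by (simp add: m_def[symmetric] powr_minus_divide mult.commute)
  then have B: "behaviour2 N p k (m * k) ?w"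
    using pullback_tendsto[OF flow \<tau> u(1) z(1)] u(2) z(2) A by (simp add: behaviour2_def)
  show ?thesis by (rule local_solution_pullback[where Q = "behaviour2 N p k (m * k)", OF flow \<tau> _ B]) (rule u_pos)
qed

lemma exists_behaviour3:
  assumes C: "0 < C"
  shows "\<exists>r\<^sub>0 w. local_solution_at_infinity N p q \<sigma> \<epsilon> r\<^sub>0 w \<and> behaviour3 N p C D w"
proof -
  have A: "- (m * spow (1 / (p - 1)) (spow (p - 1) (- (D / m)))) = D"
    using p m_pos by (simp add: spow_inverse)
  obtain \<tau> u z where \<tau>: "0 < \<tau>" and u: "continuous_on {0..\<tau>} u" "u 0 = C"
    and z: "continuous_on {0..\<tau>} z" "z 0 = spow (p - 1) (- (D / m))"
    and flow: "flow (p - 1) \<beta> (- \<epsilon> * m powr (- p)) (\<lambda>x. x powr q) {0<..<\<tau>} u z"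
    and u_pos: "\<And>t. t \<in> {0<..<\<tau>} \<Longrightarrow> 0 < u t"
    by (rule local_profile[of C "spow (p - 1) (- (D / m))" "- \<epsilon> * m powr (- p)"]) (use C in auto)
  have B: "behaviour3 N p C D (\<lambda>r. u (r powr (- m)))"
    using pullback_tendsto[OF flow \<tau> u(1) z(1)] u(2) z(2) A by (simp add: behaviour3_def)
  show ?thesis by (rule local_solution_pullback[where Q = "behaviour3 N p C D", OF flow \<tau> _ B]) (rule u_pos)
qed

section \<open>The power solution and the solutions asymptotic to it\<close>

definition \<mu> :: real where "\<mu> = - gam p q \<sigma> / m"

lemma gam_neg: "gam p q \<sigma> < 0"
  unfolding gam_def using p q pN N\<sigma> by (intro divide_neg_pos) auto

lemma \<mu>: "0 < \<mu>" and m_\<mu>: "m * \<mu> = - gam p q \<sigma>"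
  using divide_neg_pos[OF gam_neg m_pos] m_pos by (simp_all add: \<mu>_def)

lemma a_star: "0 < a_star N p q \<sigma> (-1)"
  and a_star_powr: "a_star N p q \<sigma> (-1) powr (q - (p - 1)) =
    (m * \<mu>) powr (p - 1) * (N - p + (p - 1) * (m * \<mu>))"
proof -
  define X where "X = (m * \<mu>) powr (p - 1) * (N - p + (p - 1) * (m * \<mu>))"
  have mm: "0 < m * \<mu>" using m_pos \<mu> by simp
  have "0 < (p - 1) * (m * \<mu>)" using mm p by (intro mult_pos_pos[of "p - 1"]) auto
  then have "0 < N - p + (p - 1) * (m * \<mu>)" using pN by linarith
  then have X: "0 < X" unfolding X_def using m_pos \<mu> by (intro mult_pos_pos[of "(m * \<mu>) powr (p - 1)"]) simp_all
  have g: "gam p q \<sigma> = - (m * \<mu>)" using m_\<mu> by simp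
  have rhs: "-1 * \<bar>gam p q \<sigma>\<bar> powr (p - 2) * gam p q \<sigma> * (N - p - (p - 1) * gam p q \<sigma>) = X"
    unfolding g X_def using mm by (simp add: powr_diff field_simps power2_eq_square)
  have s: "0 < q - p + 1" and s': "q - (p - 1) = q - p + 1" using q by simp_all
  have "a_star N p q \<sigma> (-1) = X powr (1 / (q - p + 1))"
    unfolding a_star_def rhs
  proof (rule the_equality)
    show "0 < X powr (1 / (q - p + 1)) \<and> (X powr (1 / (q - p + 1))) powr (q - p + 1) = X"
      using X s by (simp add: powr_powr)
    fix a :: real assume "0 < a \<and> a powr (q - p + 1) = X"
    then show "a = X powr (1 / (q - p + 1))" using s by (auto simp: powr_powr)
  qed
  then show "0 < a_star N p q \<sigma> (-1)"
    "a_star N p q \<sigma> (-1) powr (q - (p - 1)) = (m * \<mu>) powr (p - 1) * (N - p + (p - 1) * (m * \<mu>))"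
    unfolding s' X_def[symmetric] using X s by (simp_all add: powr_powr)
qed

lemma w_star_eq: "w_star N p q \<sigma> (-1) = (\<lambda>r. a_star N p q \<sigma> (-1) * (r powr (- m)) powr (- \<mu>))"
proof -
  have "- (p + \<sigma>) / (q + 1 - p) = m * \<mu>" by (simp add: m_\<mu> gam_def minus_divide_left)
  then show ?thesis by (simp add: fun_eq_iff w_star_def powr_powr)
qed

lemma emden_fowler_a_star: "emden_fowler (p - 1) q \<beta> (m powr (- p)) (a_star N p q \<sigma> (-1)) \<mu>"
proof
  have "m * (\<mu> * (q - (p - 1))) = - gam p q \<sigma> * (q - (p - 1))" by (simp add: m_\<mu>[symmetric] mult.assoc)
  also have "\<dots> = - (p + \<sigma>)" using q by (simp add: gam_def field_simps)
  also have "\<dots> = m * (\<beta> + (p - 1) + 1)" using m_\<beta> p by (simp add: m_def field_simps)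
  finally show "\<mu> * (q - (p - 1)) = \<beta> + (p - 1) + 1" using m_pos by simp
  have "N - p = m * (p - 1)" using p by (simp add: m_def)
  then have *: "N - p + (p - 1) * (m * \<mu>) = m * ((p - 1) * (\<mu> + 1))" by (simp add: algebra_simps)
  have "m powr (- p) * a_star N p q \<sigma> (-1) powr (q - (p - 1)) =
      (m powr (- p) * m powr (p - 1) * m powr 1) * (\<mu> powr (p - 1) * (p - 1) * (\<mu> + 1))"
    unfolding a_star_powr * using m_pos \<mu> by (simp add: powr_mult)
  also have "m powr (- p) * m powr (p - 1) * m powr 1 = 1"
    using m_pos by (simp only: powr_add[symmetric]) simp
  finally show "m powr (- p) * a_star N p q \<sigma> (-1) powr (q - (p - 1)) = \<mu> powr (p - 1) * (p - 1) * (\<mu> + 1)"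
    by simp
qed (use p q \<beta> m_pos a_star \<mu> in auto)

lemma global_solution_w_star: "global_solution N p q \<sigma> (-1) (w_star N p q \<sigma> (-1))"
proof -
  interpret emden_fowler "p - 1" q \<beta> "m powr (- p)" "a_star N p q \<sigma> (-1)" \<mu>
    by (rule emden_fowler_a_star)
  have "positive_solution N p q \<sigma> (-1) {0<..} (\<lambda>r. a_star N p q \<sigma> (-1) * (r powr (- m)) powr (- \<mu>))"
    by (rule positive_solution_pullback[where I = "{0<..}"
          and u = "\<lambda>t. a_star N p q \<sigma> (-1) * t powr (- \<mu>)"])
       (use power_profile_flow a_star in auto)
  then show ?thesis unfolding global_solution_def w_star_eq .
qed

lemma continuous_up_to_zero_w_star: "continuous_up_to_zero (w_star N p q \<sigma> (-1))"
  unfolding continuous_up_to_zero_def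
proof (intro exI conjI)
  show "continuous_on {0..} (w_star N p q \<sigma> (-1))"
    unfolding w_star_eq powr_powr using m_pos \<mu>
    by (intro continuous_intros continuous_on_powr') auto
qed simp

text \<open>
\<open>B\<close> is chosen such that the barriers start at \<open>C\<close>. Their common asymptotics at $t = \<infinity>$ are those of the
power solution, and \<open>c > 0\<close> since the initial momentum is negative while $t$ decreases with $r$.
\<close>

lemma exists_global_solution:
  assumes C: "0 < C"
  shows "\<exists>c>0. \<exists>w. global_solution N p q \<sigma> (-1) w \<and>
    w \<sim>[at_right 0] w_star N p q \<sigma> (-1) \<and> behaviour3 N p C c w"
proof -
  let ?a = "a_star N p q \<sigma> (-1)"
  define B where "B = (C / ?a) powr (- 1 / \<mu>)"
  have "0 < B" using C a_star by (simp add: B_def)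
  have aB: "?a * B powr (- \<mu>) = C" using C a_star \<mu> by (simp add: B_def powr_powr)
  interpret emden_fowler "p - 1" q \<beta> "m powr (- p)" ?a \<mu>
    by (rule emden_fowler_a_star)
  interpret emden_fowler_barriers "p - 1" q \<beta> "m powr (- p)" ?a \<mu> B
    by unfold_locales fact
  obtain A u z where A: "A < 0" and u: "continuous_on {0..1} u" "u 0 = initial_value"
    and z: "continuous_on {0..1} z" "z 0 = A"
    and flow: "flow (p - 1) \<beta> (m powr (- p)) (\<lambda>x. x powr q) {0<..} u z"
    and low: "\<And>t. 0 < t \<Longrightarrow> barrier \<theta>_low t \<le> u t"
    and high: "\<And>t. 0 < t \<Longrightarrow> u t \<le> barrier \<theta>_high t"
    by (rule decaying_solution) (rule that)
  let ?w = "\<lambda>r. u (r powr (- m))"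
  have flow': "flow (p - 1) \<beta> (- (-1) * m powr (- p)) (\<lambda>x. x powr q) {0<..} u z" using flow by simp
  have flow1: "flow (p - 1) \<beta> (- (-1) * m powr (- p)) (\<lambda>x. x powr q) {0<..<1} u z"
    using flow by (auto simp: flow_def)
  have u_pos: "0 < u t" if "t \<in> {0<..}" for t
    using low[of t] barrier_pos[of \<theta>_low t] that by auto
  have "global_solution N p q \<sigma> (-1) ?w" unfolding global_solution_def
    by (rule positive_solution_pullback[OF flow' u_pos]) auto
  moreover have "?w \<sim>[at_right 0] w_star N p q \<sigma> (-1)"
  proof (rule asymp_equivI')
    have "((\<lambda>t. u t / (?a * t powr (- \<mu>))) \<longlongrightarrow> 1) at_top"
    proof (rule tendsto_sandwich[OF _ _ tendsto_barrier_ratio[OF \<theta>_low(1)] tendsto_barrier_ratio[OF \<theta>_high(1)]])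
      show "\<forall>\<^sub>F t in at_top. barrier \<theta>_low t / (?a * t powr (- \<mu>)) \<le> u t / (?a * t powr (- \<mu>))"
        using eventually_gt_at_top[of 0] by eventually_elim (use low a_star in \<open>auto intro!: divide_right_mono\<close>)
      show "\<forall>\<^sub>F t in at_top. u t / (?a * t powr (- \<mu>)) \<le> barrier \<theta>_high t / (?a * t powr (- \<mu>))"
        using eventually_gt_at_top[of 0] by eventually_elim (use high a_star in \<open>auto intro!: divide_right_mono\<close>)
    qed
    from filterlim_compose[OF this at_right_to_at_top]
    show "((\<lambda>r. ?w r / w_star N p q \<sigma> (-1) r) \<longlongrightarrow> 1) (at_right 0)"
      unfolding w_star_eq .
  qed
  moreover have "behaviour3 N p C (- (m * spow (1 / (p - 1)) A)) ?w"
    using pullback_tendsto[OF flow1 _ u(1) z(1)] u(2) z(2) aB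
    by (simp add: behaviour3_def initial_value_def)
  moreover have "0 < - (m * spow (1 / (p - 1)) A)"
    using A m_pos p spow_mono_strict[of "1 / (p - 1)" A 0] by (simp add: mult_pos_neg)
  ultimately show ?thesis by blast
qed

end

section \<open>Local and global solutions\<close>

theorem theorem4p14:
  fixes N p q \<sigma> :: real
  assumes "p - 1 > 0" and "q > p - 1" and "p < N" and "N < - \<sigma>"
  shows
    "(\<forall>\<epsilon>\<in>{1, -1}.
        (\<exists>c. \<forall>C>0. c C > 0 \<and>
           (\<exists>r\<^sub>0 w. local_solution_at_infinity N p q \<sigma> \<epsilon> r\<^sub>0 w \<and> behaviour1 p \<sigma> \<epsilon> C (c C) w)) \<and>
        (\<exists>c. \<forall>k>0. c k > 0 \<and>
           (\<exists>r\<^sub>0 w. local_solution_at_infinity N p q \<sigma> \<epsilon> r\<^sub>0 w \<and> behaviour2 N p k (c k) w)) \<and>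
        (\<forall>C>0. \<forall>D. D \<noteq> 0 \<longrightarrow>
           (\<exists>r\<^sub>0 w. local_solution_at_infinity N p q \<sigma> \<epsilon> r\<^sub>0 w \<and> behaviour3 N p C D w)))
     \<and> (\<forall>r\<^sub>0 w. local_solution_at_infinity N p q \<sigma> 1 r\<^sub>0 w \<and>
           ((\<exists>C>0. \<exists>c>0. behaviour1 p \<sigma> 1 C c w) \<or>
            (\<exists>k>0. \<exists>c>0. behaviour2 N p k c w) \<or>
            (\<exists>C>0. \<exists>D. D \<noteq> 0 \<and> behaviour3 N p C D w))
         \<longrightarrow> \<not> extends_to_global N p q \<sigma> 1 r\<^sub>0 w)
     \<and> (\<forall>r\<^sub>0>0. \<not> (\<exists>w. positive_solution N p q \<sigma> 1 {0<..<r\<^sub>0} w))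
     \<and> global_solution N p q \<sigma> (-1) (w_star N p q \<sigma> (-1))
     \<and> continuous_up_to_zero (w_star N p q \<sigma> (-1))
     \<and> (\<exists>c. \<forall>C>0. c C > 0 \<and>
           (\<exists>w. global_solution N p q \<sigma> (-1) w \<and>
                w \<sim>[at_right 0] w_star N p q \<sigma> (-1) \<and>
                behaviour3 N p C (c C) w))"
proof -
  interpret exponents N p q \<sigma>
    using assms by unfold_locales auto
  have local1: "\<exists>c. \<forall>C>0. c C > 0 \<and>
      (\<exists>r\<^sub>0 w. local_solution_at_infinity N p q \<sigma> \<epsilon> r\<^sub>0 w \<and> behaviour1 p \<sigma> \<epsilon> C (c C) w)"
    if \<epsilon>: "\<epsilon> \<in> {1, -1}" for \<epsilon>
  proof (rule exI[of _ "\<lambda>C. m * (m powr (- p) * C powr q / (\<beta> + 1)) powr (1 / (p - 1))"], intro allI impI conjI)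
    fix C :: real assume C: "0 < C"
    show "0 < m * (m powr (- p) * C powr q / (\<beta> + 1)) powr (1 / (p - 1))"
      using C m_pos \<beta> by simp
    show "\<exists>r\<^sub>0 w. local_solution_at_infinity N p q \<sigma> \<epsilon> r\<^sub>0 w \<and>
        behaviour1 p \<sigma> \<epsilon> C (m * (m powr (- p) * C powr q / (\<beta> + 1)) powr (1 / (p - 1))) w"
      by (rule exists_behaviour1[OF C \<epsilon>])
  qed
  have local2: "\<exists>c. \<forall>k>0. c k > 0 \<and>
      (\<exists>r\<^sub>0 w. local_solution_at_infinity N p q \<sigma> \<epsilon> r\<^sub>0 w \<and> behaviour2 N p k (c k) w)" for \<epsilon>
    using exists_behaviour2 m_pos by (intro exI[of _ "\<lambda>k. m * k"]) auto
  have no_solution: "\<not> positive_solution N p q \<sigma> 1 {0<..<r\<^sub>0} w" if "0 < r\<^sub>0" for r\<^sub>0 w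
    using no_solution_near_zero[of p q N \<sigma> r\<^sub>0] p q_pos pN N\<sigma> that by auto
  have "\<not> extends_to_global N p q \<sigma> 1 r\<^sub>0 w" for r\<^sub>0 w
  proof
    assume "extends_to_global N p q \<sigma> 1 r\<^sub>0 w"
    then obtain v where "positive_solution N p q \<sigma> 1 {0<..} v"
      by (auto simp: extends_to_global_def global_solution_def)
    then have "positive_solution N p q \<sigma> 1 {0<..<1} v"
      unfolding positive_solution_def by simp
    with no_solution[of 1 v] show False by simp
  qed
  moreover have "\<exists>c. \<forall>C>0. c C > 0 \<and>
      (\<exists>w. global_solution N p q \<sigma> (-1) w \<and> w \<sim>[at_right 0] w_star N p q \<sigma> (-1) \<and> behaviour3 N p C (c C) w)"
    using exists_global_solution by metis
  ultimately show ?thesis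
    using local1 local2 exists_behaviour3 no_solution global_solution_w_star continuous_up_to_zero_w_star
    by blast
qed

end
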